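(* The states $$\phi^{(m_1)}_{r_1}\cdots\phi^{(m_\ell)}_{r_\ell}|0\rangle\qquad(\ell\geq0,\ m_i\in\{0,1\},\ r_{\ell-2i}\in\mathbb{Z}-\tfrac14,\ r_{\ell-2i-1}\in\mathbb{Z}+\tfrac14),$$ with $r_\ell\leq-\tfrac14$, $r_i-r_{i+1}\leq-\tfrac12$ for all $i$, and $r_i-r_{i+1}=-\tfrac12$ implying $m_i\geq m_{i+1}$, form a basis of the irreducible $\mathcal{A}_1$-vacuum module $\mathcal{L}^{(1)}_0$. The character of this module is $$\chi^{(1)}_0(q;z)=\operatorname{tr}_{\mathcal{L}^{(1)}_0}q^{L_0}z^{H_0}=\sum_{\ell_0,\ell_1=0}^\infty\frac{q^{(\ell_0+\ell_1)^2/4}}{(q)_{\ell_0}(q)_{\ell_1}}z^{\ell_0-\ell_1},$$ where $(q)_m=\prod_{j=1}^m(1-q^j)$.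
   Context: Level $k=1$. Affine algebra: the level-1 affine $\mathfrak{sl}(2)$ chiral algebra has modes $E_n,H_n,F_n$ ($n\in\mathbb{Z}$) with $[H_m,E_n]=2E_{m+n}$, $[H_m,F_n]=-2F_{m+n}$, $[E_m,F_n]=H_{m+n}+m\delta_{m+n,0}$, $[H_m,H_n]=2m\delta_{m+n,0}$, $[E_m,E_n]=[F_m,F_n]=0$; Virasoro modes by Sugawara $L_n=\frac16\sum_m:\tfrac12H_mH_{n-m}+E_mF_{n-m}+F_mE_{n-m}:$. $|0\rangle$ is the vacuum (unit norm, affine highest weight of weight 0, $L_0$-eigenvalue 0) and $|\psi_1\rangle$ the unit-norm affine highest weight state of weight 1 and conformal dimension $1/4$. Extended algebra $\mathcal{A}_1$: the simple current $\psi_1$ has two component fields $\phi^{(0)}(z),\phi^{(1)}(z)$ of conformal dimension $1/4$ with modes $\phi^{(m)}_r$ (so $[L_0,\phi^{(m)}_r]=-r\phi^{(m)}_r$ and $[H_0,\phi^{(m)}_r]=(1-2m)\phi^{(m)}_r$), where $\phi^{(0)}_{-1/4}|0\rangle=|\psi_1\rangle$. $\mathcal{A}_1$ is the $*$-algebra generated by these modes (adjoint $(\phi^{(m)}_r)^\dagger=\phi^{(1-m)}_{-r}$) containing the affine modes, with relations $\{E_r,\phi^{(1)}_s\}=\phi^{(0)}_{r+s}$, $\{E_r,\phi^{(0)}_s\}=0$, $[H_r,\phi^{(m)}_s]=(1-2m)\phi^{(m)}_{r+s}$, $\{F_r,\phi^{(0)}_s\}=\phi^{(1)}_{r+s}$,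 $\{F_r,\phi^{(1)}_s\}=0$, and, for every $\gamma\in\mathbb{Z}$, the generalised commutation relations $$\sum_{\ell\geq0}\binom{\ell-1/2+\gamma-1}{\ell}\Big[\phi^{(m)}_{r-\ell}\phi^{(n)}_{s+\ell}-(-1)^{1-m-n+\gamma}\phi^{(n)}_{s+1/2-\gamma-\ell}\phi^{(m)}_{r-1/2+\gamma+\ell}\Big]=\sum_{j=0}^{\gamma-1}\binom{r-1/4+\gamma-1}{\gamma-1-j}A^{(m,n;j)}_{r+s},$$ where the $A^{(m,n;j)}$ are the vacuum-module fields in the operator product expansions $\phi^{(0)}(z)\phi^{(0)}(w)=E(w)(z-w)^{1/2}+\dots$, $\phi^{(0)}(z)\phi^{(1)}(w)=(z-w)^{-1/2}+\tfrac12H(w)(z-w)^{1/2}+\dots$, $\phi^{(1)}(z)\phi^{(1)}(w)=F(w)(z-w)^{1/2}+\dots$. Mode indices: acting on a state of monodromy charge $\theta$, $\phi^{(m)}_r$ has $r\in\mathbb{Z}+\theta-\frac14$; the vacuum has charge $0$ and each $\phi$-mode shifts the charge by $\frac12$; $\phi^{(m)}_r|0\rangle=0$ for $r>-\frac14$. $\mathcal{L}^{(1)}_0$ is the (irreducible) $\mathcal{A}_1$-module generated from $|0\rangle$; as an affine module it is the direct sum of the irreducible level-1 affine modules of highest weights $0$ and $1$. *)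

theory Defs
  imports "HOL-Analysis.Analysis" "HOL-Computational_Algebra.Formal_Power_Series"
begin

text \<open>Conventions. The module is a complex vector space given by a carrier type 'v
  with scalar multiplication sc (complex scalars). Affine modes E n, H n, F n (n :: int);
  fields phi m r with m in {0,1} and r :: rat; A m n j k are the modes (k :: int) of the
  vacuum-module fields A^(m,n;j) appearing in the generalised commutation relations.
  Charge sectors: sec 0 = charge 0, sec 1 = charge 1/2.\<close>

definition valid_mode :: "nat \<Rightarrow> rat \<Rightarrow> bool" where
  "valid_mode c r \<longleftrightarrow> r - of_nat c / 2 + 1/4 \<in> \<int>"

definition pos_energy ::
  "(int \<Rightarrow> 'v \<Rightarrow> 'v) \<Rightarrow> (int \<Rightarrow> 'v \<Rightarrow> 'v) \<Rightarrow> (int \<Rightarrow> 'v \<Rightarrow> 'v)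
   \<Rightarrow> (nat \<Rightarrow> rat \<Rightarrow> 'v \<Rightarrow> 'v::zero) \<Rightarrow> bool" where
  "pos_energy E H F phi \<longleftrightarrow> (\<forall>v. \<exists>N::int.
      (\<forall>n>N. E n v = 0 \<and> H n v = 0 \<and> F n v = 0) \<and>
      (\<forall>m\<le>1. \<forall>r. r > of_int N \<longrightarrow> phi m r v = 0))"

text \<open>A series of vectors converging (with eventually constant partial sums, as happens
  for mode sums acting on a vector of a positive-energy module) to a value.\<close>
definition eventually_sums :: "(nat \<Rightarrow> 'v::ab_group_add) \<Rightarrow> 'v \<Rightarrow> bool" where
  "eventually_sums f w \<longleftrightarrow> (\<exists>N. \<forall>N'\<ge>N. (\<Sum>l<N'. f l) = w)"

definition sugawaraL0 ::
  "(complex \<Rightarrow> 'v \<Rightarrow> 'v) \<Rightarrow> (int \<Rightarrow> 'v \<Rightarrow> 'v) \<Rightarrow> (int \<Rightarrow> 'v \<Rightarrow> 'v) \<Rightarrow> (int \<Rightarrow> 'v \<Rightarrow> 'v)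
   \<Rightarrow> 'v \<Rightarrow> 'v::ab_group_add" where
  "sugawaraL0 sc E H F v = sc (1/6)
     (sc (1/2) (H 0 (H 0 v)) + E 0 (F 0 v) + F 0 (E 0 v) +
      (THE w. eventually_sums (\<lambda>l. let m = int l + 1 in
          H (-m) (H m v) + sc 2 (E (-m) (F m v)) + sc 2 (F (-m) (E m v))) w))"

definition mono_state :: "(nat \<Rightarrow> rat \<Rightarrow> 'v \<Rightarrow> 'v) \<Rightarrow> 'v \<Rightarrow> (nat \<times> rat) list \<Rightarrow> 'v" where
  "mono_state phi vac xs = foldr (\<lambda>(m,r) v. phi m r v) xs vac"

definition admissible :: "(nat \<times> rat) list \<Rightarrow> bool" where
  "admissible xs \<longleftrightarrow>
     (let l = length xs; m = (\<lambda>i. fst (xs ! (i - 1))); r = (\<lambda>i. snd (xs ! (i - 1))) in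
       (\<forall>i\<in>{1..l}. m i \<le> 1) \<and>
       (\<forall>i\<in>{1..l}. (even (l - i) \<longrightarrow> r i + 1/4 \<in> \<int>) \<and> (odd (l - i) \<longrightarrow> r i - 1/4 \<in> \<int>)) \<and>
       (l \<ge> 1 \<longrightarrow> r l \<le> -1/4) \<and>
       (\<forall>i\<in>{1..<l}. r i - r (i+1) \<le> -1/2) \<and>
       (\<forall>i\<in>{1..<l}. r i - r (i+1) = -1/2 \<longrightarrow> m i \<ge> m (i+1)))"

text \<open>(q)_l with q = t^4, as a formal power series in t = q^(1/4).\<close>
definition qpoch4 :: "nat \<Rightarrow> complex fps" where
  "qpoch4 l = (\<Prod>j\<in>{1..l}. 1 - fps_X ^ (4*j))"

text \<open>Coefficient of q^(N/4) z^k in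
  sum_{l0,l1>=0} q^((l0+l1)^2/4) / ((q)_l0 (q)_l1) z^(l0-l1);
  only terms with (l0+l1)^2 <= N contribute, all of which have l0, l1 <= N.\<close>
definition chi_coeff :: "int \<Rightarrow> nat \<Rightarrow> complex" where
  "chi_coeff k N = (\<Sum>(a,b)\<in>{(a,b). a \<le> N \<and> b \<le> N \<and> int a - int b = k}.
       fps_nth (fps_X ^ ((a+b)^2) * inverse (qpoch4 a) * inverse (qpoch4 b)) N)"

definition gcr_sign :: "nat \<Rightarrow> nat \<Rightarrow> int \<Rightarrow> complex" where
  "gcr_sign m n \<gamma> = (if even (1 - int m - int n + \<gamma>) then 1 else -1)"

end

theory Submission
  imports Defs
begin

text \<open>
  The generalised commutation relations with \<open>\<gamma> = 1\<close> rewrite every product of modes applied to the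
  vacuum into admissible ones, and those with \<open>\<gamma> = 2\<close> express the affine modes through products of two
  \<open>\<phi>\<close>-modes; by irreducibility the admissible states span. The admissible states of energy \<open>N/4\<close> and
  charge \<open>k\<close> are counted by the coefficient of the fermionic sum, which equals the number of
  partitions of \<open>(N - k\<^sup>2)/4\<close> (the Durfee rectangle identity). Conversely, the modes \<open>H\<^sub>n\<close> generate a
  Fock space from the lowest state \<open>\<phi>\<^sup>m \<dots> \<phi>\<^sup>m|0\<rangle>\<close> of charge \<open>k\<close> and energy \<open>k\<^sup>2/4\<close>, so the
  weight space has at least that dimension. Hence the spanning set is a basis.
\<close>

text \<open>Rewriting gives spanning but says nothing about independence, because the relations
  might have further consequences. Independence therefore comes from counting, and the obstacle is
  the lower bound for the joint eigenspaces of \<open>L0\<close> and \<open>H 0\<close>: neither a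
  known character nor an inner product enters. The lowest state of each charge is nonzero because a
  mode of the other field undoes each step of its construction; only the identity term of the
  \<open>\<gamma> = 1\<close> relation survives there. \<open>H p\<close> after
  \<open>H (- p)\<close> is injective because \<open>L0\<close> is bounded below, which already
  follows from spanning. The action of \<open>L0\<close> on \<open>H n v\<close> is read off from
  products of two \<open>\<phi>\<close>-modes instead of the Sugawara sum. The relations have
  unbounded tails. Their terms apply larger indices first, so the inner states have smaller energy,
  and induction places the whole tail in the target subspace.\<close>

unbundle no vec_syntax and fps_syntax

section \<open>Counting admissible lists\<close>

text \<open>The head is the mode applied last, so the length of the tail mod 2 is the charge sector
  on which it acts. This form follows the recursion of \<open>mono_state\<close>.\<close>

fun adm :: "(nat \<times> rat) list \<Rightarrow> bool" where
  "adm [] \<longleftrightarrow> True"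
| "adm ((m, r) # xs) \<longleftrightarrow> m \<le> 1 \<and> valid_mode (length xs mod 2) r
     \<and> (case xs of [] \<Rightarrow> r \<le> -1/4
         | (n, s) # _ \<Rightarrow> r - s \<le> -1/2 \<and> (r - s = -1/2 \<longrightarrow> n \<le> m))
     \<and> adm xs"

lemma valid_mode_mod_2:
  "valid_mode (l mod 2) r \<longleftrightarrow> (even l \<longrightarrow> r + 1/4 \<in> \<int>) \<and> (odd l \<longrightarrow> r - 1/4 \<in> \<int>)"
  by (cases "even l") (auto simp: valid_mode_def odd_iff_mod_2_eq_one)

lemma admissible_iff_nth:
  "admissible xs \<longleftrightarrow>
     (\<forall>i<length xs. fst (xs ! i) \<le> 1 \<and> valid_mode ((length xs - Suc i) mod 2) (snd (xs ! i))) \<and>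
     (xs \<noteq> [] \<longrightarrow> snd (last xs) \<le> -1/4) \<and>
     (\<forall>i. Suc i < length xs \<longrightarrow> snd (xs ! i) - snd (xs ! Suc i) \<le> -1/2 \<and>
        (snd (xs ! i) - snd (xs ! Suc i) = -1/2 \<longrightarrow> fst (xs ! Suc i) \<le> fst (xs ! i)))"
proof -
  have *: "(\<forall>i\<in>{1..l}. P i) \<longleftrightarrow> (\<forall>i<l. P (Suc i))" for l P
  proof (intro iffI ballI allI impI)
    fix i assume P: "\<forall>i<l. P (Suc i)" and "i \<in> {1..l}"
    then show "P i" by (cases i) auto
  qed auto
  have **: "(\<forall>i\<in>{1..<l}. P i) \<longleftrightarrow> (\<forall>i. Suc i < l \<longrightarrow> P (Suc i))" for l P
  proof (intro iffI ballI allI impI)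
    fix i assume P: "\<forall>i. Suc i < l \<longrightarrow> P (Suc i)" and "i \<in> {1..<l}"
    then show "P i" by (cases i) auto
  qed auto
  show ?thesis
    unfolding admissible_def Let_def * ** valid_mode_mod_2
    by (auto simp: last_conv_nth Suc_le_eq)
qed

lemma admissible_iff_adm: "admissible xs \<longleftrightarrow> adm xs"
proof (induction xs)
  case Nil
  show ?case by (simp add: admissible_iff_nth)
next
  case (Cons x xs)
  obtain m r where x: "x = (m, r)" by (cases x)
  have "admissible (x # xs) \<longleftrightarrow> m \<le> 1 \<and> valid_mode (length xs mod 2) r
     \<and> (case xs of [] \<Rightarrow> r \<le> -1/4
         | (n, s) # _ \<Rightarrow> r - s \<le> -1/2 \<and> (r - s = -1/2 \<longrightarrow> n \<le> m))
     \<and> admissible xs"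
  proof (cases xs)
    case Nil
    then show ?thesis by (auto simp: admissible_iff_nth x)
  next
    case (Cons y ys)
    obtain n s where y: "y = (n, s)" by (cases y)
    have *: "(\<forall>i. Suc i < Suc l \<longrightarrow> P i) \<longleftrightarrow> (\<forall>i<l. P i)" for l P
      by auto
    show ?thesis
      unfolding admissible_iff_nth[of "x # xs"] admissible_iff_nth[of xs]
      by (simp add: Cons x y All_less_Suc2 * conj_comms)
  qed
  then show ?case by (simp add: Cons.IH x)
qed

section \<open>Energy, charge and the encoding of admissible lists by sorted lists of
  naturals\<close>

definition energy :: "(nat \<times> rat) list \<Rightarrow> rat" where
  "energy xs = - sum_list (map snd xs)"

definition charge :: "(nat \<times> rat) list \<Rightarrow> int" where
  "charge xs = sum_list (map (\<lambda>x. 1 - 2 * int (fst x)) xs)"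

lemma energy_simps [simp]: "energy [] = 0" "energy (x # xs) = energy xs - snd x"
  by (simp_all add: energy_def)

lemma charge_simps [simp]: "charge [] = 0" "charge (x # xs) = 1 - 2 * int (fst x) + charge xs"
  by (simp_all add: charge_def)

text \<open>In an admissible list the mode with \<open>i\<close> modes to its right is
  \<open>r = -(2i + 1)/4 - \<lambda>\<close>, and the admissibility conditions say exactly that the numbers
  \<open>2\<lambda> + m\<close> increase weakly from right to left.\<close>
fun decode :: "nat list \<Rightarrow> (nat \<times> rat) list" where
  "decode [] = []"
| "decode (y # ys) = (y mod 2, - (2 * of_nat (length ys) + 1) / 4 - of_nat (y div 2)) # decode ys"

lemma length_decode [simp]: "length (decode ys) = length ys"
  by (induction ys) auto

lemma inj_decode: "decode ys = decode zs \<Longrightarrow> ys = zs"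
proof (induction ys arbitrary: zs)
  case Nil
  then show ?case by (cases zs) auto
next
  case (Cons y ys)
  then obtain z zs' where zs: "zs = z # zs'" by (cases zs) auto
  have "ys = zs'" using Cons by (auto simp: zs)
  moreover have "y = z"
    using Cons.prems \<open>ys = zs'\<close> by (simp add: zs) (metis div_mult_mod_eq)
  ultimately show ?case by (simp add: zs)
qed

lemma valid_mode_decode: "valid_mode (l mod 2) (- (2 * of_nat l + 1) / 4 - of_nat n)"
proof -
  have "(- (2 * of_nat l + 1) / 4 - of_nat n) - of_nat (l mod 2) / 2 + 1/4
     = (- of_nat (l div 2) - of_nat (l mod 2) - of_nat n :: rat)"
  proof -
    have "(of_nat l :: rat) = 2 * of_nat (l div 2) + of_nat (l mod 2)"
      by (metis mult_div_mod_eq of_nat_add of_nat_mult of_nat_numeral)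
    then show ?thesis by (simp add: field_simps)
  qed
  then show ?thesis unfolding valid_mode_def by (metis Ints_diff Ints_minus Ints_of_nat)
qed

lemma adm_decode: "sorted_wrt (\<ge>) ys \<Longrightarrow> adm (decode ys)"
proof (induction ys)
  case (Cons y ys)
  have v: "valid_mode (length ys mod 2) (- (2 * of_nat (length ys) + 1) / 4 - of_nat (y div 2))"
    by (rule valid_mode_decode)
  show ?case
  proof (cases ys)
    case Nil
    then show ?thesis using v by auto
  next
    case (Cons z zs)
    have yz: "z \<le> y" using Cons.prems Cons by auto
    then have "z div 2 \<le> y div 2" by (rule div_le_mono)
    moreover have "z div 2 = y div 2 \<Longrightarrow> z mod 2 \<le> y mod 2"
      using yz by (metis add_le_cancel_left mult_div_mod_eq)
    ultimately show ?thesis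
      using Cons.IH Cons.prems v by (auto simp: Cons field_simps)
  qed
qed simp

lemma adm_decodeE:
  assumes "adm xs"
  obtains ys where "sorted_wrt (\<ge>) ys" "decode ys = xs"
proof -
  have "adm xs \<Longrightarrow> \<exists>ys. sorted_wrt (\<ge>) ys \<and> decode ys = xs"
  proof (induction xs)
    case (Cons x xs)
    obtain m r where x: "x = (m, r)" by (cases x)
    obtain ys where ys: "sorted_wrt (\<ge>) ys" "decode ys = xs" using Cons x by auto
    have m: "m \<le> 1" and v: "valid_mode (length xs mod 2) r" using Cons.prems by (auto simp: x)
    have len: "length xs = length ys" using ys by auto
    \<comment> \<open>\<open>?r0\<close> is the index with shift 0 at this position, so
      \<open>j\<close> below is the shift of \<open>decode\<close>. It is nonnegative by the
      condition at the right end if the tail is empty, and otherwise by the gap to the next mode,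
      whose own shift is nonnegative.\<close>
    let ?r0 = "- (2 * of_nat (length ys) + 1) / 4 :: rat"
    have "?r0 - r \<in> \<int>"
      using v valid_mode_decode[of "length ys" 0] unfolding valid_mode_def len
      using Ints_diff by fastforce
    then obtain j where j: "?r0 - r = of_int j" by (auto elim: Ints_cases)
    have "of_int j \<ge> (0 :: rat)"
    proof (cases ys)
      case Nil
      then show ?thesis using Cons.prems ys j by (auto simp: x)
    next
      case (Cons z zs)
      then show ?thesis using Cons.prems ys j
        by (auto simp: x field_simps)
    qed
    then obtain n where n: "j = int n" by (metis nonneg_int_cases of_int_0_le_iff)
    have r: "r = ?r0 - of_nat n" using j n by simp
    have "sorted_wrt (\<ge>) ((2 * n + m) # ys)"
    proof (cases ys)
      case (Cons z zs)
      have "z div 2 < n \<or> (z div 2 = n \<and> z mod 2 \<le> m)"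
        using Cons.prems ys by (auto simp: x r Cons field_simps)
      moreover have "z = 2 * (z div 2) + z mod 2" "z mod 2 < 2" by simp_all
      ultimately have "z \<le> 2 * n + m" by linarith
      then show ?thesis using ys(1) by (auto simp: Cons)
    qed simp
    moreover have "decode ((2 * n + m) # ys) = x # xs"
      using m ys(2) by (simp add: x r)
    ultimately show ?case by blast
  qed (rule exI[of _ "[]"], simp)
  then show thesis using assms that by blast
qed

text \<open>The odd numbers \<open>2 * i + 1\<close> with \<open>i < l\<close> sum to
  \<open>l^2\<close>; this is the origin of the exponent \<open>(l0 + l1)^2 / 4\<close> in the
  character.\<close>

lemma energy_decode: "energy (decode ys) = of_nat (length ys ^ 2 + 4 * (\<Sum>y\<leftarrow>ys. y div 2)) / 4"
  by (induction ys) (auto simp: field_simps power2_eq_square)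

lemma charge_decode:
  "charge (decode ys) = int (length (filter even ys)) - int (length (filter odd ys))"
  by (induction ys) (auto simp: even_iff_mod_2_eq_zero odd_iff_mod_2_eq_one)

lemma energy_adm_nat: "adm xs \<Longrightarrow> \<exists>N::nat. energy xs = of_nat N / 4"
  by (metis adm_decodeE energy_decode)

section \<open>The Durfee rectangle identity for truncated sums\<close>

lemma qpoch4_0 [simp]: "qpoch4 0 = 1"
  by (simp add: qpoch4_def)

lemma qpoch4_Suc: "qpoch4 (Suc l) = qpoch4 l * (1 - fps_X ^ (4 * Suc l))"
  by (simp add: qpoch4_def)

lemma qpoch4_nth_0 [simp]: "qpoch4 l $ 0 = 1"
  by (induction l) (simp_all add: qpoch4_Suc)

lemma inverse_qpoch4_rec:
  "inverse (qpoch4 l) = inverse (qpoch4 (Suc l)) * (1 - fps_X ^ (4 * Suc l))"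
proof -
  have 1: "inverse (qpoch4 j) * qpoch4 j = 1" for j
    by (rule inverse_mult_eq_1) simp
  have "inverse (qpoch4 l) = inverse (qpoch4 l) * (inverse (qpoch4 (Suc l)) * qpoch4 (Suc l))"
    by (simp add: 1)
  also have "\<dots> = (inverse (qpoch4 l) * qpoch4 l) * (inverse (qpoch4 (Suc l)) * (1 - fps_X ^ (4 * Suc l)))"
    by (simp only: qpoch4_Suc mult_ac)
  finally show ?thesis by (simp only: 1 mult_1)
qed

text \<open>A partition with parts at most \<open>l + 1\<close> either avoids the part
  \<open>l + 1\<close> or loses one copy of it.\<close>

lemma inverse_qpoch4_Suc:
  "inverse (qpoch4 (Suc l)) = inverse (qpoch4 l) + fps_X ^ (4 * Suc l) * inverse (qpoch4 (Suc l))"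
  unfolding inverse_qpoch4_rec[of l] by (simp add: algebra_simps)

lemma inverse_qpoch4_Suc_nth:
  "inverse (qpoch4 (Suc l)) $ n = inverse (qpoch4 l) $ n
     + (if 4 * Suc l \<le> n then inverse (qpoch4 (Suc l)) $ (n - 4 * Suc l) else 0)"
  by (subst inverse_qpoch4_Suc) (auto simp: fps_X_power_mult_nth simp del: mult_Suc_right)

text \<open>Parts larger than the degree cannot occur. The stable value is the partition number of
  \<open>n / 4\<close> (0 if 4 does not divide \<open>n\<close>) and stands in for a coefficient of
  the infinite product.\<close>

lemma inverse_qpoch4_nth_stable:
  assumes "n \<le> j"
  shows "inverse (qpoch4 j) $ n = inverse (qpoch4 n) $ n"
  using assms by (induction j rule: dec_induct) (simp_all add: inverse_qpoch4_Suc_nth)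

text \<open>Partitions sorted by their largest \<open>b\<close> by \<open>b + k\<close> rectangle,
  truncated at \<open>b = M\<close>; with \<open>q = X^4\<close> the full sum is the generating
  function of all partitions, for every \<open>k\<close>.\<close>

definition durfee_sum :: "nat \<Rightarrow> nat \<Rightarrow> complex fps" where
  "durfee_sum M k = (\<Sum>b\<le>M. fps_X ^ (4 * (b * (b + k))) * inverse (qpoch4 b) * inverse (qpoch4 (b + k)))"

text \<open>Up to terms beyond the truncation, \<open>d k = durfee_sum M k - durfee_sum M (k + 1)\<close>
  satisfies \<open>d k = - q ^ (k + 1) * d (k + 1)\<close> with \<open>q = X ^ 4\<close>, which forces it to vanish.\<close>
lemma durfee_sum_diff:
  "durfee_sum M k - durfee_sum M (Suc k)
     = - (fps_X ^ (4 * Suc k) * (durfee_sum M (Suc k) - durfee_sum M (Suc (Suc k))))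
       - fps_X ^ (4 * (Suc k + M)) * (fps_X ^ (4 * (M * (M + Suc k))) * inverse (qpoch4 M)
            * inverse (qpoch4 (M + Suc (Suc k))))"
proof -
  define Y :: "complex fps" where "Y = fps_X ^ 4"
  have Y: "fps_X ^ (4 * n) = Y ^ n" for n by (simp add: Y_def power_mult)
  define q where "q l = inverse (qpoch4 l)" for l
  have q_rec: "q l = q (Suc l) * (1 - Y ^ Suc l)" for l
    unfolding q_def by (subst inverse_qpoch4_rec) (simp only: Y)
  \<comment> \<open>A common denominator: the summands for \<open>k\<close> and \<open>k + 1\<close>
    are \<open>T k b * (1 - Y^(b + k + 1))\<close> and \<open>T k b * Y^b\<close>.\<close>
  define T where "T k b = Y ^ (b * (b + k)) * q b * q (b + Suc k)" for k b
  have diff: "durfee_sum M k - durfee_sum M (Suc k)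
      = (\<Sum>b\<le>M. T k b * (1 - Y ^ b)) - (\<Sum>b\<le>M. T k b * Y ^ (b + Suc k))" for k
  proof -
    have "Y ^ (b * (b + k)) * q b * q (b + k) - Y ^ (b * (b + Suc k)) * q b * q (b + Suc k)
       = T k b * (1 - Y ^ b) - T k b * Y ^ (b + Suc k)" for b
      unfolding T_def q_rec[of "b + k"] by (simp add: algebra_simps power_add)
    then show ?thesis
      unfolding durfee_sum_def Y q_def[symmetric] sum_subtractf[symmetric] by simp
  qed
  \<comment> \<open>The term \<open>b = 0\<close> vanishes, and for \<open>b = c + 1\<close> the
    factor \<open>1 - Y^b\<close> cancels in \<open>q b\<close>, which turns the sum into one for
    \<open>k + 1\<close>.\<close>
  have shift: "T k (Suc c) * (1 - Y ^ Suc c) = Y ^ Suc k * (T (Suc k) c * Y ^ c)" for c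
  proof -
    have "T k (Suc c) * (1 - Y ^ Suc c) = Y ^ (Suc c * (Suc c + k)) * (q (Suc c) * (1 - Y ^ Suc c)) * q (Suc c + Suc k)"
      unfolding T_def by (simp only: mult_ac)
    also have "\<dots> = Y ^ (Suc k + c + c * (c + Suc k)) * q c * q (c + Suc (Suc k))"
      unfolding q_rec[symmetric] by (simp add: algebra_simps)
    finally show ?thesis unfolding T_def by (simp only: power_add mult_ac)
  qed
  have 1: "(\<Sum>b\<le>M. T k b * (1 - Y ^ b)) = Y ^ Suc k * (\<Sum>c<M. T (Suc k) c * Y ^ c)"
    unfolding sum.atMost_shift shift sum_distrib_left by simp
  have 2: "T k b * Y ^ (b + Suc k) = Y ^ Suc k * (T (Suc k) b * (1 - Y ^ (b + Suc (Suc k))))" for b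
  proof -
    have "T k b * Y ^ (b + Suc k) = Y ^ (Suc k + b * (b + Suc k)) * q b * (q (Suc (b + Suc k)) * (1 - Y ^ Suc (b + Suc k)))"
      unfolding T_def q_rec[symmetric] by (simp add: algebra_simps power_add)
    then show ?thesis unfolding T_def by (simp only: power_add mult_ac add_Suc_right)
  qed
  have 3: "(\<Sum>b\<le>M. T (Suc k) b * Y ^ b) = (\<Sum>c<M. T (Suc k) c * Y ^ c) + T (Suc k) M * Y ^ M"
    by (simp add: lessThan_Suc_atMost[symmetric])
  have "durfee_sum M k - durfee_sum M (Suc k)
     = - (Y ^ Suc k * (durfee_sum M (Suc k) - durfee_sum M (Suc (Suc k)))) - Y ^ Suc k * (T (Suc k) M * Y ^ M)"
    unfolding diff 1 2 sum_distrib_left[symmetric]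
    by (simp add: right_diff_distrib sum_subtractf 3) (simp add: algebra_simps)
  then show ?thesis
    unfolding Y q_def[symmetric] T_def by (simp only: power_add mult_ac)
qed

text \<open>Each use of the recurrence lowers the degree by \<open>4 * (k + 1)\<close> while raising
  \<open>k\<close>, hence strong induction on \<open>n\<close> with \<open>k\<close> arbitrary. The
  truncation term starts above degree \<open>M\<close>.\<close>

lemma durfee_sum_nth_Suc: "n \<le> M \<Longrightarrow> durfee_sum M (Suc k) $ n = durfee_sum M k $ n"
proof (induction n arbitrary: k rule: less_induct)
  case (less n)
  have "(durfee_sum M k - durfee_sum M (Suc k)) $ n
      = - (fps_X ^ (4 * Suc k) * (durfee_sum M (Suc k) - durfee_sum M (Suc (Suc k)))) $ n"
    unfolding durfee_sum_diff[of M k] fps_sub_nth using less.prems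
    by (subst fps_X_power_mult_nth[of "4 * (Suc k + M)"]) simp
  also have "\<dots> = 0"
    using less.IH[of "n - 4 * Suc k" "Suc k"] less.prems
    by (cases "n < 4 * Suc k") (simp_all add: fps_X_power_mult_nth)
  finally show ?case by simp
qed

text \<open>Since \<open>k\<close> does not matter, it may be replaced by \<open>k + n\<close>; then
  every rectangle with \<open>b > 0\<close> has degree above \<open>n\<close>, and only
  \<open>b = 0\<close> contributes.\<close>

lemma durfee_sum_nth:
  assumes "n \<le> M"
  shows "durfee_sum M k $ n = inverse (qpoch4 n) $ n"
proof -
  have "durfee_sum M k $ n = durfee_sum M (k + i) $ n" for i
    by (induction i) (simp_all add: durfee_sum_nth_Suc assms)
  then have "durfee_sum M k $ n = durfee_sum M (k + n) $ n" .
  also have "\<dots> = (\<Sum>b\<le>M. if b = 0 then inverse (qpoch4 (k + n)) $ n else 0)"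
    unfolding durfee_sum_def fps_sum_nth
  proof (rule sum.cong[OF refl])
    fix b assume "b \<in> {..M}"
    have "b \<noteq> 0 \<Longrightarrow> n < 4 * (b * (b + (k + n)))"
      by (cases b) (auto simp: algebra_simps)
    then show "(fps_X ^ (4 * (b * (b + (k + n)))) * inverse (qpoch4 b) * inverse (qpoch4 (b + (k + n)))) $ n
        = (if b = 0 then inverse (qpoch4 (k + n)) $ n else 0)"
      by (auto simp: mult.assoc fps_X_power_mult_nth)
  qed
  also have "\<dots> = inverse (qpoch4 (k + n)) $ n" by simp
  also have "\<dots> = inverse (qpoch4 n) $ n" by (rule inverse_qpoch4_nth_stable) simp
  finally show ?thesis .
qed

lemma chi_coeff_uminus: "chi_coeff (- k) N = chi_coeff k N"
  unfolding chi_coeff_def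
  by (rule sum.reindex_bij_witness[where i = prod.swap and j = prod.swap])
     (auto simp: mult_ac add_ac)

text \<open>On the line \<open>a = b + k\<close> the exponent is
  \<open>(2b + k)^2 = k^2 + 4b(b + k)\<close>, so the sum is \<open>X^(k^2)\<close> times a Durfee
  sum. Negative \<open>k\<close> is handled by symmetry.\<close>

lemma chi_coeff_eq:
  "chi_coeff k N = (if (nat \<bar>k\<bar>)\<^sup>2 \<le> N
     then inverse (qpoch4 N) $ (N - (nat \<bar>k\<bar>)\<^sup>2) else 0)"
proof -
  have *: "chi_coeff (int k) N = (if k\<^sup>2 \<le> N then inverse (qpoch4 N) $ (N - k\<^sup>2) else 0)" for k
  proof -
    define t :: "nat \<Rightarrow> complex fps" where
      "t b = fps_X ^ (4 * (b * (b + k))) * inverse (qpoch4 b) * inverse (qpoch4 (b + k))" for b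
    have sq: "(b + k + b)\<^sup>2 = k\<^sup>2 + 4 * (b * (b + k))" for b
      by (simp add: power2_eq_square algebra_simps)
    have tb: "fps_X ^ ((b + k + b)\<^sup>2) * inverse (qpoch4 (b + k)) * inverse (qpoch4 b) = fps_X ^ k\<^sup>2 * t b" for b
      unfolding sq t_def power_add by (simp only: mult_ac)
    \<comment> \<open>\<open>chi_coeff\<close> stops at \<open>b + k = N\<close>, the Durfee sum at
      \<open>b = N\<close>; the surplus terms have degree above \<open>N\<close>.\<close>
    have tb0: "(fps_X ^ k\<^sup>2 * t b) $ N = 0" if "b + k > N" for b
    proof -
      have "N < b + k + b" using that by simp
      also have "\<dots> \<le> (b + k + b)\<^sup>2" by (simp add: power2_eq_square)
      finally show ?thesis unfolding tb[symmetric] mult.assoc fps_X_power_mult_nth by simp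
    qed
    have "chi_coeff (int k) N = (\<Sum>b | b + k \<le> N. (fps_X ^ k\<^sup>2 * t b) $ N)"
      unfolding chi_coeff_def tb[symmetric]
    proof (rule sum.reindex_bij_witness[where i = "\<lambda>b. (b + k, b)" and j = snd])
      fix p assume *: "p \<in> {(a, b). a \<le> N \<and> b \<le> N \<and> int a - int b = int k}"
      obtain a b where ab: "p = (a, b)" by (cases p)
      have "a = b + k" using * ab by simp
      with ab have p: "p = (b + k, b)" by simp
      show "(snd p + k, snd p) = p" by (simp add: p)
      show "(fps_X ^ ((snd p + k + snd p)\<^sup>2) * inverse (qpoch4 (snd p + k)) * inverse (qpoch4 (snd p))) $ N
        = (case p of (a, b) \<Rightarrow> (fps_X ^ ((a + b)\<^sup>2) * inverse (qpoch4 a) * inverse (qpoch4 b)) $ N)"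
        by (simp add: p)
    qed auto
    also have "\<dots> = (\<Sum>b\<le>N. (fps_X ^ k\<^sup>2 * t b) $ N)"
      by (rule sum.mono_neutral_left) (auto simp: tb0 not_le)
    also have "\<dots> = (fps_X ^ k\<^sup>2 * durfee_sum N k) $ N"
      by (simp add: durfee_sum_def t_def fps_sum_nth sum_distrib_left)
    also have "\<dots> = (if k\<^sup>2 \<le> N then inverse (qpoch4 N) $ (N - k\<^sup>2) else 0)"
      by (simp add: fps_X_power_mult_nth durfee_sum_nth inverse_qpoch4_nth_stable[of "N - k\<^sup>2" N])
    finally show ?thesis .
  qed
  show ?thesis
  proof (cases "k \<ge> 0")
    case True
    then show ?thesis using *[of "nat k"] by simp
  next
    case False
    then show ?thesis using *[of "nat (- k)"] chi_coeff_uminus[of k N] by simp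
  qed
qed

section \<open>Sorted lists counted by the parities of their entries\<close>

text \<open>Reversed arguments of \<open>decode\<close> for \<open>a\<close> modes with
  \<open>m = 0\<close> and \<open>b\<close> modes with \<open>m = 1\<close>; \<open>N\<close> is the
  energy above the minimum in quarter units. The lower bound \<open>i\<close> drives the
  recursion.\<close>

definition parity_lists :: "nat \<Rightarrow> nat \<Rightarrow> nat \<Rightarrow> nat \<Rightarrow> nat list set" where
  "parity_lists i a b N = {ys. sorted ys \<and> (\<forall>y\<in>set ys. i \<le> y) \<and> length (filter even ys) = a
     \<and> length (filter odd ys) = b \<and> 4 * (\<Sum>y\<leftarrow>ys. y div 2) = N}"

lemma parity_lists_Suc:
  "parity_lists i a b N = (if even i
     then (if a = 0 then {} else if 4 * (i div 2) \<le> N then Cons i ` parity_lists i (a - 1) b (N - 4 * (i div 2)) else {})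
     else (if b = 0 then {} else if 4 * (i div 2) \<le> N then Cons i ` parity_lists i a (b - 1) (N - 4 * (i div 2)) else {}))
    \<union> parity_lists (Suc i) a b N" (is "_ = ?A \<union> _")
proof (intro equalityI subsetI)
  fix ys assume ys: "ys \<in> parity_lists i a b N"
  show "ys \<in> ?A \<union> parity_lists (Suc i) a b N"
  proof (cases "ys \<noteq> [] \<and> hd ys = i")
    case True
    then obtain zs where "ys = i # zs" by (cases ys) auto
    with ys show ?thesis by (cases "even i") (auto simp: parity_lists_def)
  next
    case False
    have "\<forall>y\<in>set ys. Suc i \<le> y"
    proof (cases ys)
      case (Cons z zs)
      then have "i \<noteq> z" "i \<le> z" "\<forall>y\<in>set zs. z \<le> y" using False ys by (auto simp: parity_lists_def)
      then show ?thesis by (auto simp: Cons)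
    qed simp
    with ys show ?thesis by (auto simp: parity_lists_def)
  qed
next
  fix ys assume "ys \<in> ?A \<union> parity_lists (Suc i) a b N"
  then show "ys \<in> parity_lists i a b N"
    by (auto simp: parity_lists_def Suc_le_eq less_imp_le split: if_splits)
qed

text \<open>Subtracting 2 from every entry keeps the parities and lowers each half by 1. This leads
  the bounds 0, 1, 2 back to 0.\<close>

lemma parity_lists_2:
  "parity_lists 2 a b N = (if 4 * (a + b) \<le> N
     then map (\<lambda>y. y + 2) ` parity_lists 0 a b (N - 4 * (a + b)) else {})"
proof -
  have flt: "length (filter even (map (\<lambda>y. y + 2) zs)) = length (filter even zs)"
    "length (filter odd (map (\<lambda>y. y + 2) zs)) = length (filter odd zs)" for zs :: "nat list"
    by (induction zs) auto
  have sm: "4 * (\<Sum>y\<leftarrow>map (\<lambda>y. y + 2) zs. y div 2)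
      = 4 * (\<Sum>y\<leftarrow>zs. y div 2) + 4 * (length (filter even zs) + length (filter odd zs))" for zs :: "nat list"
    by (induction zs) auto
  have srt: "sorted (map (\<lambda>y. y + 2) zs) = sorted zs" for zs :: "nat list"
    by (simp add: sorted_map)
  have eq: "map (\<lambda>y. y + 2) zs \<in> parity_lists 2 a b N
     \<longleftrightarrow> 4 * (a + b) \<le> N \<and> zs \<in> parity_lists 0 a b (N - 4 * (a + b))" for zs
    unfolding parity_lists_def mem_Collect_eq flt sm srt by auto
  have ex: "\<exists>zs. ys = map (\<lambda>y. y + 2) zs" if "ys \<in> parity_lists 2 a b N" for ys
  proof -
    have "ys = map (\<lambda>y. y + 2) (map (\<lambda>y. y - 2) ys)"
      unfolding map_map by (rule map_idI[symmetric]) (use that in \<open>auto simp: parity_lists_def\<close>)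
    then show ?thesis by blast
  qed
  show ?thesis
  proof (intro set_eqI iffI)
    fix ys assume ys: "ys \<in> parity_lists 2 a b N"
    then obtain zs where "ys = map (\<lambda>y. y + 2) zs" using ex by blast
    then show "ys \<in> (if 4 * (a + b) \<le> N
        then map (\<lambda>y. y + 2) ` parity_lists 0 a b (N - 4 * (a + b)) else {})"
      using ys eq[of zs] by (metis image_eqI)
  next
    fix ys assume "ys \<in> (if 4 * (a + b) \<le> N
        then map (\<lambda>y. y + 2) ` parity_lists 0 a b (N - 4 * (a + b)) else {})"
    then show "ys \<in> parity_lists 2 a b N" using eq by (metis empty_iff imageE)
  qed
qed

text \<open>Even and odd entries vary independently and form partitions with at most
  \<open>a\<close> and \<open>b\<close> parts. Bound 1 forces all even entries up by 2, which gives
  the factor \<open>q^a\<close>; bound 2 forces all entries up and gives \<open>q^(a + b)\<close>.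
  Bound 2 returns to bound 0 with the same \<open>a\<close>, \<open>b\<close> and smaller
  \<open>N\<close>, hence an induction on \<open>N\<close> inside the one on
  \<open>a + b\<close>.\<close>

lemma card_parity_lists:
  "finite (parity_lists 0 a b N) \<and>
   of_nat (card (parity_lists 0 a b N)) = (inverse (qpoch4 a) * inverse (qpoch4 b)) $ N \<and>
   finite (parity_lists 1 a b N) \<and>
   of_nat (card (parity_lists 1 a b N)) = (fps_X ^ (4 * a) * (inverse (qpoch4 a) * inverse (qpoch4 b))) $ N"
proof (induction "a + b" arbitrary: a b N rule: less_induct)
  case (less a b)
  define q where "q l = inverse (qpoch4 l)" for l
  have q_rec: "q (Suc l) = q l + fps_X ^ (4 * Suc l) * q (Suc l)" for l
    unfolding q_def by (rule inverse_qpoch4_Suc)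
  note IH = less.hyps[folded q_def]
  show ?case
    unfolding q_def[symmetric]
  proof (induction N rule: less_induct)
    case (less N)
    show ?case
    proof (cases "a + b = 0")
      case True
      \<comment> \<open>A separate case, because without entries the shift by 2 does not lower
        \<open>N\<close>.\<close>
      have "parity_lists i 0 0 N = (if N = 0 then {[]} else {})" for i
      proof -
        have "parity_lists i 0 0 N \<subseteq> {[]}"
        proof
          fix ys assume "ys \<in> parity_lists i 0 0 N"
          then show "ys \<in> {[]}" by (cases ys) (auto simp: parity_lists_def split: if_splits)
        qed
        moreover have "[] \<in> parity_lists i 0 0 N \<longleftrightarrow> N = 0" by (auto simp: parity_lists_def)
        ultimately show ?thesis by (cases "N = 0") auto
      qed
      then show ?thesis using True by (simp add: q_def)
    next
      case False
      have S2: "finite (parity_lists 2 a b N) \<and>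
          of_nat (card (parity_lists 2 a b N)) = (fps_X ^ (4 * (a + b)) * (q a * q b)) $ N"
      proof (cases "4 * (a + b) \<le> N")
        case True
        have inj: "inj_on (map (\<lambda>y. y + 2)) A" for A :: "nat list set"
          by (rule inj_on_subset[OF inj_mapI]) (auto simp: inj_def)
        have "N - 4 * (a + b) < N" using True False by (intro diff_less) auto
        then have "finite (parity_lists 0 a b (N - 4 * (a + b))) \<and>
          of_nat (card (parity_lists 0 a b (N - 4 * (a + b)))) = (q a * q b) $ (N - 4 * (a + b))"
          using less by blast
        then show ?thesis
          using True by (simp add: parity_lists_2 card_image[OF inj] fps_X_power_mult_nth del: add_2_eq_Suc')
      qed (simp add: parity_lists_2 fps_X_power_mult_nth)
      have S1: "finite (parity_lists 1 a b N) \<and>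
          of_nat (card (parity_lists 1 a b N)) = (fps_X ^ (4 * a) * (q a * q b)) $ N"
      proof (cases b)
        case 0
        then have "parity_lists 1 a b N = parity_lists 2 a b N"
          using parity_lists_Suc[of 1 a b N] unfolding Suc_1 by simp
        then show ?thesis using S2 0 by (simp only: add_0_right)
      next
        case (Suc b')
        have eq: "parity_lists 1 a b N = Cons 1 ` parity_lists 1 a b' N \<union> parity_lists 2 a b N"
          using parity_lists_Suc[of 1 a b N] unfolding Suc_1 by (simp add: Suc)
        have "1 # zs \<notin> parity_lists 2 a b N" for zs by (simp add: parity_lists_def)
        then have disj: "Cons 1 ` parity_lists 1 a b' N \<inter> parity_lists 2 a b N = {}" by blast
        have split: "fps_X ^ (4 * a) * (q a * q b) = fps_X ^ (4 * a) * (q a * q b') + fps_X ^ (4 * (a + b)) * (q a * q b)"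
        proof -
          have "q b = q b' + fps_X ^ (4 * b) * q b" unfolding Suc by (rule q_rec)
          then have "fps_X ^ (4 * a) * (q a * q b) = fps_X ^ (4 * a) * (q a * (q b' + fps_X ^ (4 * b) * q b))"
            by (rule arg_cong[where f = "\<lambda>x. fps_X ^ (4 * a) * (q a * x)"])
          also have "\<dots> = fps_X ^ (4 * a) * (q a * q b') + (fps_X ^ (4 * a) * fps_X ^ (4 * b)) * (q a * q b)"
            by (simp only: distrib_left mult_ac)
          finally show ?thesis by (simp only: power_add[symmetric] distrib_left)
        qed
        have "finite (parity_lists 1 a b' N)"
          "of_nat (card (parity_lists 1 a b' N)) = (fps_X ^ (4 * a) * (q a * q b')) $ N"
          using IH[of a b' N] Suc by simp_all
        then show ?thesis
          using S2 unfolding eq split by (simp add: card_Un_disjoint[OF _ _ disj] card_image del: One_nat_def distrib_left_numeral)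
      qed
      have S0: "finite (parity_lists 0 a b N) \<and>
          of_nat (card (parity_lists 0 a b N)) = (q a * q b) $ N"
      proof (cases a)
        case 0
        then show ?thesis using S1 parity_lists_Suc[of 0 a b N] by simp
      next
        case (Suc a')
        have eq: "parity_lists 0 a b N = Cons 0 ` parity_lists 0 a' b N \<union> parity_lists 1 a b N"
          using parity_lists_Suc[of 0 a b N] by (simp add: Suc)
        have "0 # zs \<notin> parity_lists 1 a b N" for zs by (simp add: parity_lists_def)
        then have disj: "Cons 0 ` parity_lists 0 a' b N \<inter> parity_lists 1 a b N = {}" by blast
        have split: "q a * q b = q a' * q b + fps_X ^ (4 * a) * (q a * q b)"
          unfolding Suc by (subst (1) q_rec) (simp add: algebra_simps)
        have "finite (parity_lists 0 a' b N)"
          "of_nat (card (parity_lists 0 a' b N)) = (q a' * q b) $ N"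
          using IH[of a' b N] Suc by simp_all
        then show ?thesis
          using S1 unfolding eq by (subst split) (simp add: card_Un_disjoint[OF _ _ disj] card_image del: One_nat_def)
      qed
      show ?thesis using S0 S1 by blast
    qed
  qed
qed

lemma card_adm_weight:
  defines "P \<equiv> \<lambda>N k. {xs. adm xs \<and> energy xs = of_nat N / 4 \<and> charge xs = k}"
  shows "finite (P N k)" "of_nat (card (P N k)) = chi_coeff k N"
proof -
  define I where "I = {(a, b). a \<le> N \<and> b \<le> N \<and> int a - int b = k}"
  \<comment> \<open>The subtracted \<open>(a + b)^2\<close> is the minimal energy from
    \<open>energy_decode\<close>. Reversal is needed below because \<open>decode\<close> expects
    weakly decreasing lists.\<close>
  define S where "S = (\<lambda>(a, b). if (a + b)\<^sup>2 \<le> N then parity_lists 0 a b (N - (a + b)\<^sup>2) else {})"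
  have len: "length (filter even ys) + length (filter odd ys) = length ys" for ys :: "nat list"
    by (rule sum_length_filter_compl)
  have fS: "finite (S p)" for p
    by (auto simp: S_def card_parity_lists split: prod.splits)
  have fI: "finite I"
    by (rule finite_subset[of _ "{..N} \<times> {..N}"]) (auto simp: I_def)
  have P: "P N k = (\<lambda>ys. decode (rev ys)) ` (\<Union>p\<in>I. S p)"
  proof (intro equalityI subsetI)
    fix xs assume xs: "xs \<in> P N k"
    then obtain ys where ys: "sorted_wrt (\<ge>) ys" "decode ys = xs" by (auto simp: P_def elim: adm_decodeE)
    define a b where "a = length (filter even ys)" and "b = length (filter odd ys)"
    have e: "(a + b)\<^sup>2 + 4 * (\<Sum>y\<leftarrow>ys. y div 2) = N"
    proof -
      have "of_nat ((length ys)\<^sup>2 + 4 * (\<Sum>y\<leftarrow>ys. y div 2)) / 4 = (of_nat N / 4 :: rat)"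
        using xs ys(2) energy_decode[of ys] by (simp add: P_def)
      then show ?thesis unfolding a_def b_def len by (simp only: divide_cancel_right of_nat_eq_iff) simp
    qed
    have "a + b \<le> (a + b)\<^sup>2" by (simp add: power2_eq_square)
    then have "a + b \<le> N" using e by linarith
    moreover have "int a - int b = k"
      using xs ys(2) charge_decode[of ys] by (simp add: P_def a_def b_def)
    moreover have "rev ys \<in> S (a, b)"
      using ys(1) e by (auto simp: S_def parity_lists_def sorted_wrt_rev a_def b_def rev_filter[symmetric] rev_map[symmetric])
    ultimately have "rev ys \<in> (\<Union>p\<in>I. S p)" by (intro UN_I[of "(a, b)"]) (simp_all add: I_def)
    then show "xs \<in> (\<lambda>ys. decode (rev ys)) ` (\<Union>p\<in>I. S p)" using ys(2)
      by (metis (no_types, lifting) image_eqI rev_rev_ident)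
  next
    fix xs assume "xs \<in> (\<lambda>ys. decode (rev ys)) ` (\<Union>p\<in>I. S p)"
    then obtain a b ys where ys: "xs = decode (rev ys)" "ys \<in> S (a, b)" "(a, b) \<in> I" by auto
    then have le: "(a + b)\<^sup>2 \<le> N" and y: "ys \<in> parity_lists 0 a b (N - (a + b)\<^sup>2)" by (auto simp: S_def split: if_splits)
    have l: "length ys = a + b" using y len[of ys] by (auto simp: parity_lists_def)
    have s: "(\<Sum>y\<leftarrow>rev ys. y div 2) = (\<Sum>y\<leftarrow>ys. y div 2)"
      by (simp add: rev_map[symmetric])
    have "energy xs = of_nat N / 4"
      unfolding ys(1) energy_decode s length_rev l using y le by (simp add: parity_lists_def)
    moreover have "charge xs = k"
      unfolding ys(1) charge_decode using y ys(3) by (auto simp: parity_lists_def I_def rev_filter[symmetric])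
    moreover have "adm xs"
      unfolding ys(1) using y by (intro adm_decode) (simp add: parity_lists_def sorted_wrt_rev)
    ultimately show "xs \<in> P N k" by (simp add: P_def)
  qed
  show "finite (P N k)" unfolding P using fS fI by auto
  have "inj (\<lambda>ys. decode (rev ys))" by (auto simp: inj_def dest: inj_decode)
  then have "card (P N k) = card (\<Union>p\<in>I. S p)"
    unfolding P by (intro card_image) (auto intro: inj_on_subset)
  also have "\<dots> = (\<Sum>p\<in>I. card (S p))"
  proof (rule card_UN_disjoint[OF fI])
    show "\<forall>p\<in>I. finite (S p)" using fS by blast
    show "\<forall>p\<in>I. \<forall>p'\<in>I. p \<noteq> p' \<longrightarrow> S p \<inter> S p' = {}"
      by (auto simp: S_def parity_lists_def split: if_splits)
  qed
  also have "of_nat \<dots> = (\<Sum>p\<in>I. of_nat (card (S p)) :: complex)" by simp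
  also have "\<dots> = chi_coeff k N"
    unfolding chi_coeff_def I_def[symmetric]
    by (rule sum.cong) (auto simp: S_def card_parity_lists mult.assoc fps_X_power_mult_nth)
  finally show "of_nat (card (P N k)) = chi_coeff k N" .
qed

section \<open>Spanning\<close>

lemma valid_mode_shift:
  "c \<le> 1 \<Longrightarrow> valid_mode (1 - c) r \<longleftrightarrow> valid_mode c (r + 1/2)"
  "c \<le> 1 \<Longrightarrow> valid_mode c r \<longleftrightarrow> valid_mode (1 - c) (r - 1/2)"
proof -
  have *: "x \<in> \<int> \<longleftrightarrow> y \<in> \<int>" if "x - y \<in> \<int>" for x y :: rat
    using that by (metis Ints_add Ints_diff diff_add_cancel add_diff_cancel_left')
  assume "c \<le> 1"
  then have c: "c = 0 \<or> c = 1" by auto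
  show "valid_mode (1 - c) r \<longleftrightarrow> valid_mode c (r + 1/2)"
    unfolding valid_mode_def by (rule *) (use c in auto)
  show "valid_mode c r \<longleftrightarrow> valid_mode (1 - c) (r - 1/2)"
    unfolding valid_mode_def by (rule *) (use c in auto)
qed

lemma valid_mode_sum:
  assumes "c \<le> 1" "valid_mode c s" "valid_mode (1 - c) r"
  obtains k where "r + s = of_int k"
proof -
  have "(r - of_nat (1 - c) / 2 + 1/4) + (s - of_nat c / 2 + 1/4) \<in> \<int>"
    using assms(2,3) unfolding valid_mode_def by (rule Ints_add[rotated])
  then have "r + s \<in> \<int>" using assms(1) by (cases c) (auto simp: algebra_simps)
  then show thesis using that by (auto elim: Ints_cases)
qed

text \<open>Indices valid for adjacent sectors differ by a half-odd number, so no value lies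
  strictly between -1/2 and 1/2.\<close>

lemma valid_mode_gap:
  assumes "c \<le> 1" "valid_mode c s" "valid_mode (1 - c) r" "\<not> r - s \<le> -1/2"
  shows "r - s \<ge> 1/2"
proof -
  have "(r - of_nat (1 - c) / 2 + 1/4) - (s - of_nat c / 2 + 1/4) + of_nat (1 - c) - 1 \<in> \<int>"
    using assms(2,3) unfolding valid_mode_def
    by (rule Ints_diff[OF Ints_add[OF Ints_diff[rotated] Ints_of_nat] Ints_1])
  then have "r - s - 1/2 \<in> \<int>" using assms(1) by (cases c) (auto simp: algebra_simps)
  then obtain k where k: "r - s - 1/2 = of_int k" by (auto elim: Ints_cases)
  then have "of_int k > (-1 :: rat)" using assms(4) by simp
  then have "k \<ge> 0" by linarith
  then show ?thesis using k by simp
qed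

lemma eventually_sums_unique: "eventually_sums f v \<Longrightarrow> eventually_sums f w \<Longrightarrow> v = w"
  unfolding eventually_sums_def by (metis nle_le)

lemma eventually_sums_eventually_zero:
  assumes "\<And>l. l \<ge> N \<Longrightarrow> f l = 0"
  shows "eventually_sums f (\<Sum>l<N. f l)"
  unfolding eventually_sums_def
proof (intro exI allI impI)
  fix N' assume "N' \<ge> N"
  then show "(\<Sum>l<N'. f l) = (\<Sum>l<N. f l)"
    by (intro sum.mono_neutral_right) (use assms in auto)
qed

lemma eventually_sums_add:
  assumes "eventually_sums f v" "eventually_sums g w"
  shows "eventually_sums (\<lambda>l. f l + g l) (v + w)"
proof -
  obtain N M where "\<forall>n\<ge>N. (\<Sum>l<n. f l) = v" "\<forall>n\<ge>M. (\<Sum>l<n. g l) = w"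
    using assms unfolding eventually_sums_def by blast
  then show ?thesis
    unfolding eventually_sums_def by (intro exI[of _ "max N M"]) (simp add: sum.distrib)
qed

lemma energy_nonneg: "adm xs \<Longrightarrow> 0 \<le> energy xs"
  using energy_adm_nat by fastforce

context vector_space
begin

text \<open>\<open>S\<close> acts as an annihilation and \<open>T\<close> as a creation operator.
  Applying \<open>S\<close> to a coincidence between the span of \<open>B1\<close> and the image of
  the span of \<open>B2\<close> removes the first part, and injectivity of \<open>S\<close> after
  \<open>T\<close> does the rest.\<close>

lemma independent_Un_image:
  assumes S: "Vector_Spaces.linear scale scale S" and T: "Vector_Spaces.linear scale scale T"
    and B1: "independent B1" "finite B1" "\<And>x. x \<in> B1 \<Longrightarrow> S x = 0"
    and B2: "finite B2" "independent B2" "\<And>x. x \<in> span B2 \<Longrightarrow> S (T x) = 0 \<Longrightarrow> x = 0"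
  shows "independent (B1 \<union> T ` B2) \<and> card (B1 \<union> T ` B2) = card B1 + card B2"
  using B2
proof (induction B2 rule: finite_induct)
  case empty
  then show ?case using B1 by simp
next
  case (insert x B)
  interpret S: Vector_Spaces.linear scale scale S by fact
  interpret T: Vector_Spaces.linear scale scale T by fact
  have x: "x \<notin> span B" and B: "independent B"
    using insert.prems(1) insert.hyps(2) unfolding independent_insert by simp_all
  have sub: "span B \<subseteq> span (insert x B)" by (rule span_mono) auto
  have IH: "independent (B1 \<union> T ` B) \<and> card (B1 \<union> T ` B) = card B1 + card B"
    by (rule insert.IH[OF B], rule insert.prems(2)[OF subsetD[OF sub]])
  have notin: "T x \<notin> span (B1 \<union> T ` B)"
  proof
    assume "T x \<in> span (B1 \<union> T ` B)"
    then obtain a b where a: "a \<in> span B1" and b: "b \<in> span (T ` B)" and eq: "T x = a + b"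
      unfolding span_Un by blast
    obtain y where y: "y \<in> span B" "b = T y" using b unfolding T.span_image by blast
    have "S a = 0" by (rule S.eq_0_on_span[OF B1(3) a])
    moreover have "T (x - y) = a" unfolding T.diff eq y(2) by simp
    ultimately have "S (T (x - y)) = 0" by simp
    moreover have "x - y \<in> span (insert x B)"
      by (rule span_diff[OF span_base subsetD[OF sub y(1)]]) simp
    ultimately have "x - y = 0" by (rule insert.prems(2)[rotated])
    then show False using x y(1) by simp
  qed
  then have "T x \<notin> B1 \<union> T ` B" using span_base[of "T x"] by metis
  moreover have "finite (B1 \<union> T ` B)" using insert.hyps(1) B1(2) by simp
  ultimately have "card (insert (T x) (B1 \<union> T ` B)) = card B1 + card (insert x B)"
    using IH insert.hyps by simp
  moreover have "independent (insert (T x) (B1 \<union> T ` B))"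
    using independent_insertI[OF notin] IH by blast
  moreover have "B1 \<union> T ` insert x B = insert (T x) (B1 \<union> T ` B)" by (simp only: image_insert Un_insert_right)
  ultimately show ?case by (simp only: simp_thms)
qed

end

section \<open>The module and the direct consequences of the generalised commutation
  relations\<close>

locale simple_current_module = vector_space sc
  for sc :: "complex \<Rightarrow> 'v::ab_group_add \<Rightarrow> 'v" +
  fixes E H F :: "int \<Rightarrow> 'v \<Rightarrow> 'v"
    and phi :: "nat \<Rightarrow> rat \<Rightarrow> 'v \<Rightarrow> 'v"
    and A :: "nat \<Rightarrow> nat \<Rightarrow> nat \<Rightarrow> int \<Rightarrow> 'v \<Rightarrow> 'v"
    and vac :: 'v
    and sec :: "nat \<Rightarrow> 'v set"
  assumes lin_aff: "\<And>n. Vector_Spaces.linear sc sc (E n) \<and> Vector_Spaces.linear sc sc (H n)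
                        \<and> Vector_Spaces.linear sc sc (F n)"
    and lin_phi: "\<And>m r. Vector_Spaces.linear sc sc (phi m r)"
    and EF: "\<And>a b v. E a (F b v) - F b (E a v) = H (a+b) v + (if a + b = 0 then sc (of_int a) v else 0)"
    and HH: "\<And>a b v. H a (H b v) - H b (H a v) = (if a + b = 0 then sc (2 * of_int a) v else 0)"
    and H_phi: "\<And>a m s v. m \<le> 1 \<Longrightarrow>
        H a (phi m s v) - phi m s (H a v) = sc (1 - 2 * of_nat m) (phi m (of_int a + s) v)"
    and sec_sub: "\<And>c. c \<le> 1 \<Longrightarrow> subspace (sec c)"
    and aff_sec: "\<And>c n v. c \<le> 1 \<Longrightarrow> v \<in> sec c \<Longrightarrow> E n v \<in> sec c \<and> H n v \<in> sec c \<and> F n v \<in> sec c"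
    and phi_sec: "\<And>c m r v. c \<le> 1 \<Longrightarrow> m \<le> 1 \<Longrightarrow> v \<in> sec c \<Longrightarrow> valid_mode c r \<Longrightarrow> phi m r v \<in> sec (1 - c)"
    and phi_invalid: "\<And>c m r v. c \<le> 1 \<Longrightarrow> v \<in> sec c \<Longrightarrow> \<not> valid_mode c r \<Longrightarrow> phi m r v = 0"
    and vac_sec: "vac \<in> sec 0"
    and vac_nz: "vac \<noteq> 0"
    and vac_aff: "\<And>n. n > 0 \<Longrightarrow> E n vac = 0 \<and> H n vac = 0 \<and> F n vac = 0"
    and vac_E0: "E 0 vac = 0"
    and vac_H0: "H 0 vac = 0"
    and vac_phi: "\<And>m r. r > -1/4 \<Longrightarrow> phi m r vac = 0"
    and posen: "pos_energy E H F phi"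
    and L0_phi: "\<And>m r v. m \<le> 1 \<Longrightarrow>
        sugawaraL0 sc E H F (phi m r v) - phi m r (sugawaraL0 sc E H F v)
          = sc (- of_rat r) (phi m r v)"
    and A00: "\<And>k v. A 0 0 0 k v = 0 \<and> A 0 0 1 k v = E k v"
    and A01: "\<And>k v. A 0 1 0 k v = (if k = 0 then v else 0) \<and> A 0 1 1 k v = sc (1/2) (H k v)"
    and A11: "\<And>k v. A 1 1 0 k v = 0 \<and> A 1 1 1 k v = F k v"
    and gcr: "\<And>c v m n \<gamma> r s k. c \<le> 1 \<Longrightarrow> v \<in> sec c \<Longrightarrow> m \<le> 1 \<Longrightarrow> n \<le> 1 \<Longrightarrow>
        valid_mode c s \<Longrightarrow> valid_mode (1 - c) r \<Longrightarrow> r + s = of_int k \<Longrightarrow>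
        eventually_sums
          (\<lambda>l. sc ((of_nat l - 1/2 + of_int \<gamma> - 1) gchoose l)
                  (phi m (r - of_nat l) (phi n (s + of_nat l) v)
                   - sc (gcr_sign m n \<gamma>)
                       (phi n (s + 1/2 - of_int \<gamma> - of_nat l) (phi m (r - 1/2 + of_int \<gamma> + of_nat l) v))))
          (\<Sum>j<nat \<gamma>. sc ((of_rat r - 1/4 + of_int \<gamma> - 1) gchoose (nat \<gamma> - 1 - j)) (A m n j k v))"
    and irred: "\<And>W. subspace W \<Longrightarrow> W \<noteq> {0} \<Longrightarrow>
        (\<forall>n. \<forall>w\<in>W. E n w \<in> W \<and> H n w \<in> W \<and> F n w \<in> W) \<Longrightarrow>
        (\<forall>m\<le>1. \<forall>r. \<forall>w\<in>W. phi m r w \<in> W) \<Longrightarrow> W = UNIV"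
begin

lemma linear_span_mem:
  assumes "Vector_Spaces.linear sc sc f" "w \<in> span S" "\<And>x. x \<in> S \<Longrightarrow> f x \<in> span T"
  shows "f w \<in> span T"
proof -
  interpret f: Vector_Spaces.linear sc sc f by fact
  have "f ` span S = span (f ` S)" by (simp add: f.span_image)
  also have "\<dots> \<subseteq> span T" using assms(3) by (intro span_minimal) auto
  finally show ?thesis using assms(2) by auto
qed

lemma linear_phi: "module_hom sc sc (phi m r)"
  and linear_E: "module_hom sc sc (E i)"
  and linear_H: "module_hom sc sc (H i)"
  and linear_F: "module_hom sc sc (F i)"
  using lin_phi[of m r] lin_aff[of i] by (auto simp: Vector_Spaces.linear_def)

lemmas phi_simps = module_hom.add[OF linear_phi] module_hom.scale[OF linear_phi]
  module_hom.zero[OF linear_phi] module_hom.diff[OF linear_phi]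

lemmas H_simps = module_hom.add[OF linear_H] module_hom.scale[OF linear_H]
  module_hom.zero[OF linear_H] module_hom.diff[OF linear_H]

text \<open>On a given vector the relation is a finite sum whose coefficient at \<open>l = 0\<close>
  is 1. Modulo a subspace containing the tail it is an exchange of two modes with a correction
  term.\<close>

lemma gcr_modulo_diff:
  assumes c: "c \<le> 1" "v \<in> sec c" "m \<le> 1" "n \<le> 1" "valid_mode c s" "valid_mode (1 - c) r"
    and k: "r + s = of_int k" and U: "subspace U"
    and fst: "\<And>l. l \<ge> 1 \<Longrightarrow> phi m (r - of_nat l) (phi n (s + of_nat l) v) \<in> U"
    and snd: "\<And>l. l \<ge> 1 \<Longrightarrow>
      phi n (s + 1/2 - of_int \<gamma> - of_nat l) (phi m (r - 1/2 + of_int \<gamma> + of_nat l) v) \<in> U"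
  shows "phi m r (phi n s v)
    - sc (gcr_sign m n \<gamma>) (phi n (s + 1/2 - of_int \<gamma>) (phi m (r - 1/2 + of_int \<gamma>) v))
    - (\<Sum>j<nat \<gamma>. sc ((of_rat r - 1/4 + of_int \<gamma> - 1) gchoose (nat \<gamma> - 1 - j)) (A m n j k v)) \<in> U"
proof -
  let ?t = "\<lambda>l. sc ((of_nat l - 1/2 + of_int \<gamma> - 1) gchoose l)
                  (phi m (r - of_nat l) (phi n (s + of_nat l) v)
                   - sc (gcr_sign m n \<gamma>)
                       (phi n (s + 1/2 - of_int \<gamma> - of_nat l) (phi m (r - 1/2 + of_int \<gamma> + of_nat l) v)))"
  let ?A = "\<Sum>j<nat \<gamma>. sc ((of_rat r - 1/4 + of_int \<gamma> - 1) gchoose (nat \<gamma> - 1 - j)) (A m n j k v)"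
  have aux: "x - a = - y" if "a = x + y" for a x y :: 'v using that by simp
  obtain N where N: "\<forall>N'\<ge>N. (\<Sum>l<N'. ?t l) = ?A"
    using gcr[OF c k, of \<gamma>] unfolding eventually_sums_def by blast
  \<comment> \<open>\<open>Suc N\<close> instead of \<open>N\<close> ensures that the term
    \<open>l = 0\<close> is present.\<close>
  have "?A = (\<Sum>l<Suc N. ?t l)" using N[rule_format, of "Suc N"] by (simp only: le_SucI order_refl)
  also have "\<dots> = ?t 0 + (\<Sum>l<N. ?t (Suc l))"
    by (rule sum.lessThan_Suc_shift)
  finally have "?t 0 - ?A = - (\<Sum>l<N. ?t (Suc l))" by (rule aux)
  moreover have "(\<Sum>l<N. ?t (Suc l)) \<in> U"
  proof (rule subspace_sum[OF U])
    fix l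
    show "?t (Suc l) \<in> U"
      using fst[of "Suc l"] snd[of "Suc l"] by (intro subspace_scale[OF U] subspace_diff[OF U]) auto
  qed
  ultimately have "?t 0 - ?A \<in> U" using subspace_neg[OF U] by (simp only:)
  then show ?thesis by simp
qed

lemma gcr_modulo:
  assumes c: "c \<le> 1" "v \<in> sec c" "m \<le> 1" "n \<le> 1" "valid_mode c s" "valid_mode (1 - c) r"
    and k: "r + s = of_int k" and U: "subspace U"
    and rhs: "(\<Sum>j<nat \<gamma>. sc ((of_rat r - 1/4 + of_int \<gamma> - 1) gchoose (nat \<gamma> - 1 - j)) (A m n j k v)) \<in> U"
    and fst: "\<And>l. l \<ge> 1 \<Longrightarrow> phi m (r - of_nat l) (phi n (s + of_nat l) v) \<in> U"
    and snd: "\<And>l. l \<ge> 1 \<Longrightarrow>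
      phi n (s + 1/2 - of_int \<gamma> - of_nat l) (phi m (r - 1/2 + of_int \<gamma> + of_nat l) v) \<in> U"
  shows "phi m r (phi n s v)
    - sc (gcr_sign m n \<gamma>) (phi n (s + 1/2 - of_int \<gamma>) (phi m (r - 1/2 + of_int \<gamma>) v)) \<in> U"
  using subspace_add[OF U gcr_modulo_diff[OF c k U fst snd] rhs] by simp

text \<open>For \<open>\<gamma> = 2\<close> the right side is a multiple of the field with
  \<open>j = 0\<close>, which is 0 or the identity, plus the field with \<open>j = 1\<close> with
  coefficient 1. The subspace \<open>U\<close> is left open so that the lemma serves both the
  invariance of the span and the weight of \<open>H n v\<close>.\<close>

lemma affine_mode_mem:
  assumes c: "c \<le> 1" "v \<in> sec c" and U: "subspace U"
    and phi2: "\<And>m n r s. m \<le> 1 \<Longrightarrow> n \<le> 1 \<Longrightarrow> r + s = of_int k \<Longrightarrow> phi m r (phi n s v) \<in> U"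
    and v: "k = 0 \<Longrightarrow> v \<in> U"
  shows "E k v \<in> U" "H k v \<in> U" "F k v \<in> U"
proof -
  define s :: rat where "s = of_nat c / 2 - 1/4"
  define r :: rat where "r = of_int k - s"
  have val: "valid_mode c s" "valid_mode (1 - c) r" and k: "r + s = of_int k"
    using c(1) by (auto simp: valid_mode_def s_def r_def field_simps)
  have key: "A m n 1 k v \<in> U" if mn: "m \<le> 1" "n \<le> 1" and A0: "A m n 0 k v \<in> U" for m n
  proof -
    let ?t = "\<lambda>l. sc ((of_nat l - 1/2 + of_int 2 - 1) gchoose l)
                  (phi m (r - of_nat l) (phi n (s + of_nat l) v)
                   - sc (gcr_sign m n 2)
                       (phi n (s + 1/2 - of_int 2 - of_nat l) (phi m (r - 1/2 + of_int 2 + of_nat l) v)))"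
    obtain N where N: "(\<Sum>l<N. ?t l)
      = (\<Sum>j<nat 2. sc ((of_rat r - 1/4 + of_int 2 - 1) gchoose (nat 2 - 1 - j)) (A m n j k v))"
      using gcr[OF c mn val k, of 2] unfolding eventually_sums_def by blast
    have "(\<Sum>l<N. ?t l) \<in> U"
    proof (rule subspace_sum[OF U])
      fix l
      show "?t l \<in> U"
        using k by (intro subspace_scale[OF U] subspace_diff[OF U] phi2 mn) auto
    qed
    then have "sc ((of_rat r - 1/4 + 2 - 1) gchoose 1) (A m n 0 k v) + A m n 1 k v \<in> U"
      unfolding N by (simp add: numeral_2_eq_2)
    then have "(sc ((of_rat r - 1/4 + 2 - 1) gchoose 1) (A m n 0 k v) + A m n 1 k v)
        - sc ((of_rat r - 1/4 + 2 - 1) gchoose 1) (A m n 0 k v) \<in> U"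
      using A0 by (intro subspace_diff[OF U] subspace_scale[OF U])
    then show ?thesis by simp
  qed
  have 0: "0 \<in> U" by (rule subspace_0[OF U])
  show "E k v \<in> U" using key[of 0 0] A00 0 by simp
  show "F k v \<in> U" using key[of 1 1] A11 0 by simp
  have "sc (1/2) (H k v) \<in> U" using key[of 0 1] A01[of k v] 0 v by (cases "k = 0") simp_all
  then have "sc 2 (sc (1/2) (H k v)) \<in> U" by (rule subspace_scale[OF U])
  then show "H k v \<in> U" by simp
qed

section \<open>Straightening of products of modes\<close>

abbreviation mono :: "(nat \<times> rat) list \<Rightarrow> 'v" where
  "mono \<equiv> mono_state phi vac"

lemma mono_simps [simp]: "mono [] = vac" "mono ((m, r) # xs) = phi m r (mono xs)"
  by (simp_all add: mono_state_def)

lemma mono_sec: "adm xs \<Longrightarrow> mono xs \<in> sec (length xs mod 2)"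
proof (induction xs)
  case Nil
  then show ?case by (simp add: vac_sec)
next
  case (Cons x xs)
  obtain m r where x: "x = (m, r)" by (cases x)
  have "mono (x # xs) \<in> sec (1 - length xs mod 2)"
    using Cons unfolding x mono_simps by (intro phi_sec) auto
  moreover have "1 - length xs mod 2 = length (x # xs) mod 2"
    by (simp add: mod2_eq_if)
  ultimately show ?case by simp
qed

definition adm_upto :: "nat \<Rightarrow> rat \<Rightarrow> (nat \<times> rat) list set" where
  "adm_upto L e = {xs. adm xs \<and> length xs \<le> L \<and> energy xs = e}"

text \<open>The relation with \<open>\<gamma> = 1\<close> expresses a disordered pair by pairs in which the state acted on
  by the left mode has smaller energy. The only exception is \<open>\<phi>\<^sup>0\<^sub>r \<phi>\<^sup>1\<^sub>s\<close> with \<open>r = s - 1/2\<close>, which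
  becomes \<open>\<phi>\<^sup>1\<^sub>r \<phi>\<^sup>0\<^sub>s\<close>; so \<open>m = 1\<close> has to be treated before \<open>m = 0\<close>.\<close>
lemma phi_mono_mem_span:
  "adm xs \<Longrightarrow> m \<le> 1 \<Longrightarrow>
     phi m r (mono xs) \<in> span (mono ` adm_upto (Suc (length xs)) (energy xs - r))"
proof (induction "(length xs, nat \<lfloor>4 * energy xs\<rfloor>, 1 - m)" arbitrary: xs m r
    rule: wf_induct_rule[OF wf_lex_prod[OF wf_less_than wf_lex_prod[OF wf_less_than wf_less_than]]])
  \<comment> \<open>Shorter lists serve for the inner mode, smaller energy for the outer mode, and
    \<open>1 - m\<close> for the exceptional exchange. The floor loses nothing, since four times an
    admissible energy is a natural number.\<close>
  case (1 xs m r)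
  note hyp = 1(1) and xs = 1(2) and m = 1(3)
  have IH_len: "phi m' r' (mono ys) \<in> span (mono ` adm_upto (Suc (length ys)) (energy ys - r'))"
    if "adm ys" "m' \<le> 1" "length ys < length xs" for ys m' r'
    using hyp[of ys m' r'] that by simp
  have IH_energy: "phi m' r' (mono ys) \<in> span (mono ` adm_upto (Suc (length ys)) (energy ys - r'))"
    if "adm ys" "m' \<le> 1" "length ys \<le> length xs" "energy ys < energy xs" for ys m' r'
  proof -
    have *: "\<exists>N. 4 * energy zs = of_nat N" if "adm zs" for zs
      using energy_adm_nat[OF that] by (auto simp: field_simps)
    obtain N where N: "4 * energy xs = of_nat N" using *[OF xs] ..
    obtain M where M: "4 * energy ys = of_nat M" using *[OF \<open>adm ys\<close>] ..
    have "of_nat M < (of_nat N :: rat)" using that(4) N M by linarith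
    then have "nat \<lfloor>4 * energy ys\<rfloor> < nat \<lfloor>4 * energy xs\<rfloor>" unfolding N M by simp
    then show ?thesis by (intro hyp) (use that in auto)
  qed
  have IH_mode: "phi 1 r' (mono ys) \<in> span (mono ` adm_upto (Suc (length ys)) (energy ys - r'))"
    if "adm ys" "length ys \<le> length xs" "energy ys = energy xs" "m = 0" for ys r'
    by (intro hyp) (use that in auto)
  have sub: "span (mono ` adm_upto L e) \<subseteq> span (mono ` adm_upto L' e)" if "L \<le> L'" for L L' e
    using that by (intro span_mono image_mono) (auto simp: adm_upto_def)
  define U where "U = span (mono ` adm_upto (Suc (length xs)) (energy xs - r))"
  have U: "subspace U" unfolding U_def by (rule subspace_span)
  have "phi m r (mono xs) \<in> U"
  proof (cases "valid_mode (length xs mod 2) r")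
    case False
    then have "phi m r (mono xs) = 0" using mono_sec[OF xs] by (intro phi_invalid) auto
    then show ?thesis using subspace_0[OF U] by simp
  next
    case True
    have direct: ?thesis if "adm ((m, r) # xs)"
    proof -
      have "mono ((m, r) # xs) \<in> U"
        unfolding U_def by (rule span_base, rule imageI) (use that in \<open>simp add: adm_upto_def\<close>)
      then show ?thesis by simp
    qed
    show ?thesis
    proof (cases xs)
      case Nil
      show ?thesis
      proof (cases "r \<le> -1/4")
        case True
        then show ?thesis using \<open>valid_mode (length xs mod 2) r\<close> m by (intro direct) (simp add: Nil)
      next
        case False
        then show ?thesis using subspace_0[OF U] by (simp add: Nil vac_phi)
      qed
    next
      case (Cons x ys)
      obtain n s where x: "x = (n, s)" by (cases x)
      define c where "c = length ys mod 2"
      define v where "v = mono ys"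
      have c1: "c \<le> 1" by (simp add: c_def)
      have xs_eq: "xs = (n, s) # ys" by (simp add: Cons x)
      have n: "n \<le> 1" and ys: "adm ys" and s: "valid_mode c s" using xs by (auto simp: xs_eq c_def)
      have v: "v \<in> sec c" unfolding v_def c_def by (rule mono_sec[OF ys])
      have r: "valid_mode (1 - c) r"
        using True unfolding xs_eq c_def by (simp add: mod2_eq_if split: if_splits)
      obtain k where k: "r + s = of_int k" using valid_mode_sum[OF c1 s r] .
      show ?thesis
      proof (cases "r - s \<le> -1/2 \<and> (r - s = -1/2 \<longrightarrow> n \<le> m)")
        case True
        then show ?thesis using \<open>valid_mode (length xs mod 2) r\<close> m xs by (intro direct) (auto simp: xs_eq)
      next
        case bad: False
        have gap: "r - s \<ge> 1/2 \<or> (r - s = -1/2 \<and> m = 0 \<and> n = 1)"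
          using bad valid_mode_gap[OF c1 s r] m n by linarith
        \<comment> \<open>An inner index above \<open>s\<close> gives an inner state of energy below
          that of \<open>mono xs\<close>. Once it is expanded by \<open>IH_len\<close>, the outer
          mode falls under \<open>IH_energy\<close>.\<close>
        have low: "phi m2 r2 (phi m1 r1 v) \<in> U"
          if "m1 \<le> 1" "m2 \<le> 1" "r1 + r2 = r + s" "r1 > s" for m1 m2 r1 r2
        proof -
          have "phi m1 r1 v \<in> span (mono ` adm_upto (length xs) (energy ys - r1))"
            using IH_len[OF ys that(1), of r1] by (simp add: v_def xs_eq)
          then have "phi m2 r2 (phi m1 r1 v) \<in> span (mono ` adm_upto (Suc (length xs)) (energy ys - r1 - r2))"
          proof (rule linear_span_mem[OF lin_phi], elim imageE)
            fix x zs assume zs: "x = mono zs" "zs \<in> adm_upto (length xs) (energy ys - r1)"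
            then have "phi m2 r2 x \<in> span (mono ` adm_upto (Suc (length zs)) (energy zs - r2))"
              using that unfolding zs(1) by (intro IH_energy) (auto simp: adm_upto_def xs_eq)
            then show "phi m2 r2 x \<in> span (mono ` adm_upto (Suc (length xs)) (energy ys - r1 - r2))"
              using zs sub[of "Suc (length zs)" "Suc (length xs)"] by (auto simp: adm_upto_def)
          qed
          moreover have "energy ys - r1 - r2 = energy xs - r" using that by (simp add: xs_eq)
          ultimately show ?thesis unfolding U_def by simp
        qed
        \<comment> \<open>The identity term of the operator product leaves \<open>v\<close>, a list
          with two modes fewer and the required energy.\<close>
        have vU: "v \<in> U" if "k = 0"
          unfolding U_def v_def
          by (rule span_base, rule imageI) (use that k ys in \<open>simp add: adm_upto_def xs_eq algebra_simps\<close>)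
        have *: "(\<Sum>j<nat 1. sc ((of_rat r' - 1/4 + of_int 1 - 1) gchoose (nat 1 - 1 - j)) (A m' n' j k v)) \<in> U"
          if "(m', n') \<in> {(0, 0), (1, 1), (0, 1)}" for m' n' r'
          using that A00 A11 A01[of k v] vU subspace_0[OF U] by auto
        show ?thesis
        proof (cases "m = 1 \<and> n = 0")
          case False
          have "phi m r (phi n s v) - sc (gcr_sign m n 1) (phi n (s + 1/2 - of_int 1) (phi m (r - 1/2 + of_int 1) v)) \<in> U"
          proof (rule gcr_modulo[OF c1 v m n s r k U *])
            show "(m, n) \<in> {(0, 0), (1, 1), (0, 1)}" using False m n by auto
          next
            fix l :: nat assume "l \<ge> 1"
            then show "phi m (r - of_nat l) (phi n (s + of_nat l) v) \<in> U"
              using m n by (intro low) auto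
            show "phi n (s + 1/2 - of_int 1 - of_nat l) (phi m (r - 1/2 + of_int 1 + of_nat l) v) \<in> U"
              using m n gap \<open>l \<ge> 1\<close> by (intro low) auto
          qed
          \<comment> \<open>The inner index is \<open>r + 1/2\<close>: above \<open>s\<close> if the
            gap is at least 1/2, but equal to \<open>s\<close> in the exceptional case, where the
            inner energy is unchanged and \<open>IH_mode\<close> applies.\<close>
          moreover have "phi n (s + 1/2 - of_int 1) (phi m (r - 1/2 + of_int 1) v) \<in> U"
          proof (cases "r - s \<ge> 1/2")
            case True
            then show ?thesis using m n by (intro low) auto
          next
            case False
            then have rs: "r = s - 1/2" and m0: "m = 0" and n1: "n = 1" using gap by auto
            have "phi 0 s v \<in> span (mono ` adm_upto (length xs) (energy xs))"
              using IH_len[OF ys, of 0 s] by (simp add: v_def xs_eq)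
            then have "phi 1 r (phi 0 s v) \<in> span (mono ` adm_upto (Suc (length xs)) (energy xs - r))"
            proof (rule linear_span_mem[OF lin_phi], elim imageE)
              fix x zs assume zs: "x = mono zs" "zs \<in> adm_upto (length xs) (energy xs)"
              then have "phi 1 r x \<in> span (mono ` adm_upto (Suc (length zs)) (energy zs - r))"
                using m0 unfolding zs(1) by (intro IH_mode) (auto simp: adm_upto_def)
              then show "phi 1 r x \<in> span (mono ` adm_upto (Suc (length xs)) (energy xs - r))"
                using zs sub[of "Suc (length zs)" "Suc (length xs)"] by (auto simp: adm_upto_def)
            qed
            then show ?thesis by (simp add: rs m0 n1 U_def)
          qed
          ultimately have "phi m r (phi n s v) - sc (gcr_sign m n 1) (phi n (s + 1/2 - of_int 1) (phi m (r - 1/2 + of_int 1) v))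
             + sc (gcr_sign m n 1) (phi n (s + 1/2 - of_int 1) (phi m (r - 1/2 + of_int 1) v)) \<in> U"
            by (intro subspace_add[OF U] subspace_scale[OF U])
          then show ?thesis by (simp add: xs_eq v_def)
        next
          case True
          then have m1: "m = 1" and n0: "n = 0" and d: "r - s \<ge> 1/2" using gap by auto
          \<comment> \<open>The operator products are given for the order \<open>(0, 1)\<close>. The
            indices \<open>s - 1/2\<close> and \<open>r + 1/2\<close> are chosen so that the
            exchanged product of that relation is the wanted one.\<close>
          have "phi 0 (s - 1/2) (phi 1 (r + 1/2) v)
              - sc (gcr_sign 0 1 1) (phi 1 (r + 1/2 + 1/2 - of_int 1) (phi 0 (s - 1/2 - 1/2 + of_int 1) v)) \<in> U"
          proof (rule gcr_modulo[OF c1 v _ _ _ _ _ U *])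
            show "valid_mode c (r + 1/2)" "valid_mode (1 - c) (s - 1/2)"
              using r s valid_mode_shift[OF c1] by auto
            show "s - 1/2 + (r + 1/2) = of_int k" using k by simp
          next
            fix l :: nat assume "l \<ge> 1"
            then show "phi 0 (s - 1/2 - of_nat l) (phi 1 (r + 1/2 + of_nat l) v) \<in> U"
              using d by (intro low) auto
            show "phi 1 (r + 1/2 + 1/2 - of_int 1 - of_nat l) (phi 0 (s - 1/2 - 1/2 + of_int 1 + of_nat l) v) \<in> U"
              using d \<open>l \<ge> 1\<close> by (intro low) auto
          qed auto
          moreover have "phi 0 (s - 1/2) (phi 1 (r + 1/2) v) \<in> U" using d by (intro low) auto
          ultimately have "phi 0 (s - 1/2) (phi 1 (r + 1/2) v)
              - sc (gcr_sign 0 1 1) (phi 1 (r + 1/2 + 1/2 - of_int 1) (phi 0 (s - 1/2 - 1/2 + of_int 1) v))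
              - phi 0 (s - 1/2) (phi 1 (r + 1/2) v) \<in> U"
            by (rule subspace_diff[OF U])
          then show ?thesis by (simp add: xs_eq v_def m1 n0 gcr_sign_def)
        qed
      qed
    qed
  qed
  then show ?case unfolding U_def .
qed

lemma phi_span_adm:
  assumes "w \<in> span (mono ` Collect adm)" "m \<le> 1"
  shows "phi m r w \<in> span (mono ` Collect adm)"
  using assms(1)
proof (rule linear_span_mem[OF lin_phi], elim imageE)
  fix x xs assume "x = mono xs" "xs \<in> Collect adm"
  then show "phi m r x \<in> span (mono ` Collect adm)"
    using phi_mono_mem_span[of xs m r] assms(2)
      span_mono[OF image_mono[of "adm_upto (Suc (length xs)) (energy xs - r)" "Collect adm"]]
    by (auto simp: adm_upto_def)
qed

lemma span_adm: "span (mono ` Collect adm) = UNIV"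
proof (rule irred)
  let ?W = "span (mono ` Collect adm)"
  have *: "E k (mono xs) \<in> ?W \<and> H k (mono xs) \<in> ?W \<and> F k (mono xs) \<in> ?W" if "adm xs" for k xs
  proof -
    have xs: "mono xs \<in> ?W" using that by (intro span_base) auto
    show ?thesis
      by (intro conjI; rule affine_mode_mem[OF _ mono_sec[OF that]])
         (simp_all add: phi_span_adm xs)
  qed
  show "\<forall>n. \<forall>w\<in>?W. E n w \<in> ?W \<and> H n w \<in> ?W \<and> F n w \<in> ?W"
  proof (intro allI ballI conjI)
    fix n w assume w: "w \<in> ?W"
    show "E n w \<in> ?W"
      by (rule linear_span_mem[of "E n", OF _ w]) (use lin_aff * in auto)
    show "H n w \<in> ?W"
      by (rule linear_span_mem[of "H n", OF _ w]) (use lin_aff * in auto)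
    show "F n w \<in> ?W"
      by (rule linear_span_mem[of "F n", OF _ w]) (use lin_aff * in auto)
  qed
  show "\<forall>m\<le>1. \<forall>r. \<forall>w\<in>?W. phi m r w \<in> ?W" using phi_span_adm by blast
  have "vac \<in> ?W" by (intro span_base image_eqI[of _ _ "[]"]) auto
  then show "?W \<noteq> {0}" using vac_nz by auto
qed auto

section \<open>Weight spaces\<close>

abbreviation L0 :: "'v \<Rightarrow> 'v" where
  "L0 \<equiv> sugawaraL0 sc E H F"

text \<open>The Sugawara sum is a \<open>THE\<close>-value. By \<open>posen\<close> it is finite on
  every vector, so the value exists, is unique and inherits linearity.\<close>

lemma linear_L0: "module_hom sc sc L0"
proof -
  define t where "t = (\<lambda>v l. let m = int l + 1 in
          H (-m) (H m v) + sc 2 (E (-m) (F m v)) + sc 2 (F (-m) (E m v)))"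
  define T where "T = (\<lambda>v. THE w. eventually_sums (t v) w)"
  note lin = module_hom.add[OF linear_E] module_hom.add[OF linear_H] module_hom.add[OF linear_F]
    module_hom.scale[OF linear_E] module_hom.scale[OF linear_H] module_hom.scale[OF linear_F]
    module_hom.zero[OF linear_E] module_hom.zero[OF linear_H] module_hom.zero[OF linear_F]
  have L0: "L0 v = sc (1/6) (sc (1/2) (H 0 (H 0 v)) + E 0 (F 0 v) + F 0 (E 0 v) + T v)" for v
    unfolding sugawaraL0_def T_def t_def ..
  have T: "eventually_sums (t v) (T v)" for v
  proof -
    obtain N where N: "\<And>n. n > N \<Longrightarrow> E n v = 0 \<and> H n v = 0 \<and> F n v = 0"
      using posen unfolding pos_energy_def by blast
    have "t v l = 0" if "l \<ge> nat N" for l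
      using N[of "int l + 1"] that by (simp add: t_def lin)
    then have "eventually_sums (t v) (\<Sum>l<nat N. t v l)"
      by (rule eventually_sums_eventually_zero)
    then show ?thesis unfolding T_def by (rule theI) (erule eventually_sums_unique, fact)
  qed
  have "t (u + v) = (\<lambda>l. t u l + t v l)" for u v
    by (rule ext) (simp add: t_def lin Let_def algebra_simps)
  then have add: "T (u + v) = T u + T v" for u v
    using T[of "u + v"] eventually_sums_add[OF T[of u] T[of v]] by (metis eventually_sums_unique)
  have "t (sc a v) = (\<lambda>l. sc a (t v l))" for a v
    by (rule ext) (simp add: t_def lin Let_def scale_right_distrib mult.commute)
  moreover have "eventually_sums (\<lambda>l. sc a (t v l)) (sc a (T v))" for a v
    using T[of v] unfolding eventually_sums_def scale_sum_right[symmetric] by metis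
  ultimately have scl: "T (sc a v) = sc a (T v)" for a v
    using T[of "sc a v"] by (metis eventually_sums_unique)
  have "Vector_Spaces.linear sc sc L0"
    unfolding Vector_Spaces.linear_iff
    by (intro conjI allI vector_space_axioms; simp add: L0 lin add scl scale_right_distrib)
  then show ?thesis by (simp add: Vector_Spaces.linear_def)
qed

lemmas L0_simps = module_hom.add[OF linear_L0] module_hom.scale[OF linear_L0]
  module_hom.zero[OF linear_L0] module_hom.diff[OF linear_L0]

lemma L0_vac: "L0 vac = 0"
proof -
  note z = module_hom.zero[OF linear_E] module_hom.zero[OF linear_H] module_hom.zero[OF linear_F]
  have "E 0 (F 0 vac) = 0" using EF[of 0 0 vac] by (simp add: vac_E0 vac_H0 z)
  moreover have "(THE w. eventually_sums (\<lambda>l::nat. 0::'v) w) = 0"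
    by (rule the_equality) (auto simp: eventually_sums_def)
  ultimately show ?thesis
    using vac_aff by (simp add: sugawaraL0_def vac_E0 vac_H0 z Let_def)
qed

definition weight_space :: "rat \<Rightarrow> int \<Rightarrow> 'v set" where
  "weight_space h k = {v. L0 v = sc (of_rat h) v \<and> H 0 v = sc (of_int k) v}"

lemma subspace_weight_space: "subspace (weight_space h k)"
  unfolding subspace_def weight_space_def
  by (auto simp: L0_simps H_simps scale_right_distrib scale_left_commute)

lemma phi_weight:
  assumes "m \<le> 1" "v \<in> weight_space h k"
  shows "phi m r v \<in> weight_space (h - r) (k + 1 - 2 * int m)"
proof -
  have "L0 (phi m r v) = phi m r (L0 v) + sc (- of_rat r) (phi m r v)"
    using L0_phi[OF assms(1), of r v] by (simp add: algebra_simps)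
  moreover have "H 0 (phi m r v) = phi m r (H 0 v) + sc (1 - 2 * of_nat m) (phi m r v)"
    using H_phi[OF assms(1), of 0 r v] by (simp add: algebra_simps)
  ultimately show ?thesis
    using assms(2) by (simp add: weight_space_def phi_simps scale_left_distrib[symmetric] of_rat_diff del: scale_minus_left)
qed

lemma vac_weight: "vac \<in> weight_space 0 0"
  by (simp add: weight_space_def L0_vac vac_H0)

lemma mono_weight: "adm xs \<Longrightarrow> mono xs \<in> weight_space (energy xs) (charge xs)"
proof (induction xs)
  case (Cons x xs)
  obtain m r where x: "x = (m, r)" by (cases x)
  then have "phi m r (mono xs) \<in> weight_space (energy xs - r) (charge xs + 1 - 2 * int m)"
    using Cons by (intro phi_weight) auto
  then show ?case by (simp add: x algebra_simps)
qed (simp add: vac_weight)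

text \<open>Each product of two \<open>\<phi>\<close>-modes with total index \<open>n\<close> lowers
  \<open>L0\<close> by \<open>n\<close>, and \<open>H n v\<close> lies in any subspace containing
  these products.\<close>

lemma H_weight:
  assumes "c \<le> 1" "v \<in> sec c" "v \<in> weight_space h k"
  shows "H n v \<in> weight_space (h - of_int n) k"
proof -
  \<comment> \<open>Only the \<open>L0\<close> condition can be imposed here, as the products
    occurring have different charges; the \<open>H 0\<close> eigenvalue follows separately from
    \<open>HH\<close>.\<close>
  let ?U = "{u. L0 u = sc (of_rat (h - of_int n)) u}"
  have "subspace ?U"
    unfolding subspace_def by (auto simp: L0_simps scale_right_distrib scale_left_commute)
  then have "H n v \<in> ?U"
  proof (rule affine_mode_mem(2)[OF assms(1,2)])
    fix m n' :: nat and r s assume "m \<le> 1" "n' \<le> 1" and rs: "r + s = rat_of_int n"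
    then have "phi m r (phi n' s v) \<in> weight_space (h - s - r) (k + 1 - 2 * int n' + 1 - 2 * int m)"
      using assms(3) by (intro phi_weight)
    moreover have "h - s - r = h - of_int n" using rs by simp
    ultimately show "phi m r (phi n' s v) \<in> ?U" by (simp add: weight_space_def)
  next
    assume "n = 0"
    then show "v \<in> ?U" using assms(3) by (simp add: weight_space_def)
  qed
  moreover have "H 0 (H n v) = H n (H 0 v)"
    using HH[of 0 n v] by (simp split: if_splits)
  ultimately show ?thesis using assms(3) by (simp add: weight_space_def H_simps)
qed

text \<open>Applying \<open>L0\<close> and \<open>H 0\<close> minus their eigenvalues at
  \<open>w0\<close> removes that term and rescales the others; for \<open>w\<close> different from
  \<open>w0\<close> one of the two factors is nonzero.\<close>

lemma weight_sum_eq_0: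
  assumes "finite I" "\<And>w. w \<in> I \<Longrightarrow> x w \<in> weight_space (fst w) (snd w)" "(\<Sum>w\<in>I. x w) = 0" "w \<in> I"
  shows "x w = 0"
  using assms
proof (induction I arbitrary: x w rule: finite_induct)
  case (insert w0 I)
  have L: "L0 (x w) = sc (of_rat (fst w)) (x w)" and K: "H 0 (x w) = sc (of_int (snd w)) (x w)"
    if "w \<in> insert w0 I" for w
    using insert.prems(1)[OF that] by (simp_all add: weight_space_def)
  have w0: "x w0 = - (\<Sum>w\<in>I. x w)"
    using insert.prems(2) insert.hyps by (simp add: eq_neg_iff_add_eq_0)
  have ann: "x w = 0" if w: "w \<in> I" for w
  proof -
    have "sc (of_rat (fst w0)) (x w0) = - (\<Sum>w\<in>I. sc (of_rat (fst w)) (x w))"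
      using arg_cong[OF w0, of L0] L
      by (simp add: module_hom.neg[OF linear_L0] module_hom.sum[OF linear_L0])
    then have "(\<Sum>w\<in>I. sc (of_rat (fst w) - of_rat (fst w0)) (x w)) = 0"
      using w0 by (simp add: scale_left_diff_distrib sum_subtractf scale_sum_right[symmetric])
    moreover have "sc (of_rat (fst w) - of_rat (fst w0)) (x w) \<in> weight_space (fst w) (snd w)" if "w \<in> I" for w
      using insert.prems(1) that by (intro subspace_scale[OF subspace_weight_space]) auto
    ultimately have 1: "sc (of_rat (fst w) - of_rat (fst w0)) (x w) = 0"
      using insert.IH[of "\<lambda>w. sc (of_rat (fst w) - of_rat (fst w0)) (x w)" w] w by blast
    have "sc (of_int (snd w0)) (x w0) = - (\<Sum>w\<in>I. sc (of_int (snd w)) (x w))"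
      using arg_cong[OF w0, of "H 0"] K
      by (simp add: module_hom.neg[OF linear_H] module_hom.sum[OF linear_H])
    then have "(\<Sum>w\<in>I. sc (of_int (snd w) - of_int (snd w0)) (x w)) = 0"
      using w0 by (simp add: scale_left_diff_distrib sum_subtractf scale_sum_right[symmetric])
    moreover have "sc (of_int (snd w) - of_int (snd w0)) (x w) \<in> weight_space (fst w) (snd w)" if "w \<in> I" for w
      using insert.prems(1) that by (intro subspace_scale[OF subspace_weight_space]) auto
    ultimately have 2: "sc (of_int (snd w) - of_int (snd w0)) (x w) = 0"
      using insert.IH[of "\<lambda>w. sc (of_int (snd w) - of_int (snd w0)) (x w)" w] w by blast
    have "w \<noteq> w0" using w insert.hyps by auto
    then show ?thesis using 1 2 by (auto simp: prod_eq_iff)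
  qed
  then have "x w0 = 0" using w0 by simp
  then show ?case using ann insert.prems(3) by blast
qed simp

definition adm_weight :: "rat \<Rightarrow> int \<Rightarrow> (nat \<times> rat) list set" where
  "adm_weight h k = {xs. adm xs \<and> energy xs = h \<and> charge xs = k}"

text \<open>Only spanning enters, so the result is available before independence. An expansion of
  \<open>v\<close> is grouped by weight; subtracting \<open>v\<close> from its own component gives
  weight vectors with sum zero.\<close>

lemma weight_space_eq_span: "weight_space h k = span (mono ` adm_weight h k)"
proof (intro equalityI subsetI)
  fix v assume v: "v \<in> weight_space h k"
  have "v \<in> span (mono ` Collect adm)" by (simp add: span_adm)
  then obtain t r where t: "finite t" "t \<subseteq> mono ` Collect adm" "v = (\<Sum>a\<in>t. sc (r a) a)"
    unfolding span_explicit by blast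
  then obtain X where X: "X \<subseteq> Collect adm" "inj_on mono X" "t = mono ` X"
    unfolding subset_image_inj by blast
  have fX: "finite X" using t(1) X by (simp add: finite_image_iff)
  define g where "g xs = (energy xs, charge xs)" for xs
  define y where "y w = (\<Sum>xs\<in>{xs\<in>X. g xs = w}. sc (r (mono xs)) (mono xs))" for w
  have ysp: "y w \<in> span (mono ` adm_weight (fst w) (snd w))" for w
    unfolding y_def using X(1)
    by (intro span_sum span_scale span_base imageI) (auto simp: adm_weight_def g_def)
  have sub: "span (mono ` adm_weight h k) \<subseteq> weight_space h k" for h k
    by (intro span_minimal subspace_weight_space) (auto simp: adm_weight_def mono_weight)
  have "v = (\<Sum>xs\<in>X. sc (r (mono xs)) (mono xs))"
    unfolding t(3) X(3) by (simp add: sum.reindex[OF X(2)])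
  also have "\<dots> = (\<Sum>w\<in>g ` X. y w)"
    unfolding y_def by (rule sum.image_gen[OF fX])
  \<comment> \<open>\<open>(h, k)\<close> is adjoined because the expansion might contain no state
    of this weight.\<close>
  also have "\<dots> = (\<Sum>w\<in>insert (h, k) (g ` X). y w)"
  proof (rule sum.mono_neutral_left)
    show "\<forall>w\<in>insert (h, k) (g ` X) - g ` X. y w = 0"
    proof
      fix w assume "w \<in> insert (h, k) (g ` X) - g ` X"
      then have "{xs \<in> X. g xs = w} = {}" by blast
      then show "y w = 0" unfolding y_def by (simp only: sum.empty)
    qed
  qed (use fX in auto)
  finally have vy: "v = (\<Sum>w\<in>insert (h, k) (g ` X). y w)" .
  define x where "x w = y w - (if w = (h, k) then v else 0)" for w
  have "x (h, k) = 0"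
  proof (rule weight_sum_eq_0[of "insert (h, k) (g ` X)" x])
    show "finite (insert (h, k) (g ` X))" using fX by simp
    show "x w \<in> weight_space (fst w) (snd w)" for w
    proof -
      have "(if w = (h, k) then v else 0) \<in> weight_space (fst w) (snd w)"
        using v subspace_0[OF subspace_weight_space] by simp
      moreover have "y w \<in> weight_space (fst w) (snd w)" using ysp sub by blast
      ultimately show ?thesis unfolding x_def by (rule subspace_diff[OF subspace_weight_space, rotated])
    qed
    show "(\<Sum>w\<in>insert (h, k) (g ` X). x w) = 0"
      unfolding x_def sum_subtractf vy[symmetric] using fX by (simp only: sum.delta finite_insert finite_imageI) simp
  qed simp
  then show "v \<in> span (mono ` adm_weight h k)" using ysp[of "(h, k)"] by (simp add: x_def)
next
  fix v assume "v \<in> span (mono ` adm_weight h k)"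
  moreover have "mono ` adm_weight h k \<subseteq> weight_space h k"
    by (auto simp: adm_weight_def mono_weight)
  ultimately show "v \<in> weight_space h k"
    using span_minimal[OF _ subspace_weight_space] by blast
qed

lemma weight_space_neg: "h < 0 \<Longrightarrow> weight_space h k = {0}"
proof -
  assume "h < 0"
  then have "adm_weight h k = {}" using energy_nonneg by (force simp: adm_weight_def)
  then show ?thesis by (simp add: weight_space_eq_span)
qed

section \<open>Fock spaces\<close>

text \<open>Energies are nonnegative, so some power of \<open>H p\<close> kills \<open>x\<close>. If
  \<open>j + 1\<close> is the least such power, commuting gives
  \<open>H p^(j+1) (H (- p) x) = 2p(j+1) H p^j x\<close>, which is nonzero, while the assumption
  makes the left side vanish.\<close>

lemma H_pair_injective:
  assumes p: "p > 0" and c: "c \<le> 1" "x \<in> sec c" "x \<in> weight_space h k"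
    and 0: "H p (H (- p) x) = 0"
  shows "x = 0"
proof (rule ccontr)
  assume x: "x \<noteq> 0"
  have pow: "(H p ^^ t) x \<in> sec c \<and> (H p ^^ t) x \<in> weight_space (h - of_int p * of_nat t) k" for t
  proof (induction t)
    case (Suc t)
    then have "H p ((H p ^^ t) x) \<in> weight_space (h - of_int p * of_nat t - of_int p) k"
      using H_weight[OF c(1)] by blast
    then show ?case using Suc aff_sec[OF c(1)] by (simp add: algebra_simps)
  qed (use c in simp)
  obtain t :: nat where t: "of_nat t > h" using reals_Archimedean2[of "of_rat h :: real"]
    by (metis of_rat_less of_rat_of_nat_eq)
  have "of_int p * of_nat t \<ge> (of_nat t :: rat)"
    using p mult_right_mono[of 1 "of_int p :: rat" "of_nat t"] by simp
  then have "h - of_int p * of_nat t < 0" using t by linarith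
  then have ex: "(H p ^^ t) x = 0" using pow[of t] weight_space_neg by blast
  define i where "i = (LEAST t. (H p ^^ t) x = 0)"
  have i: "(H p ^^ i) x = 0" unfolding i_def by (rule LeastI[of _ t]) (rule ex)
  with x obtain j where j: "i = Suc j" by (cases i) auto
  have nz: "(H p ^^ j) x \<noteq> 0" using not_less_Least[of j "\<lambda>t. (H p ^^ t) x = 0"] by (simp add: i_def[symmetric] j)
  have comm: "H p (H (- p) y) = sc (2 * of_int p) y + H (- p) (H p y)" for y
    using HH[of p "- p" y] by (simp add: algebra_simps)
  have "(H p ^^ Suc t) (H (- p) x)
      = sc (2 * of_int p * of_nat (Suc t)) ((H p ^^ t) x) + H (- p) ((H p ^^ Suc t) x)" for t
  proof (induction t)
    case 0
    then show ?case by (simp add: comm)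
  next
    case (Suc t)
    have "(H p ^^ Suc (Suc t)) (H (- p) x) = H p ((H p ^^ Suc t) (H (- p) x))" by simp
    also have "\<dots> = sc (2 * of_int p * of_nat (Suc t)) ((H p ^^ Suc t) x) + H p (H (- p) ((H p ^^ Suc t) x))"
      unfolding Suc by (simp add: H_simps)
    also have "\<dots> = sc (2 * of_int p * of_nat (Suc t) + 2 * of_int p) ((H p ^^ Suc t) x)
        + H (- p) ((H p ^^ Suc (Suc t)) x)"
      unfolding comm scale_left_distrib by (simp add: add.assoc)
    also have "2 * of_int p * of_nat (Suc t) + 2 * of_int p = 2 * of_int p * (of_nat (Suc (Suc t)) :: complex)"
      by (simp add: algebra_simps)
    finally show ?case .
  qed
  from this[of j] have "sc (2 * of_int p * of_nat (Suc j)) ((H p ^^ j) x) = (H p ^^ Suc j) (H (- p) x)"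
    using i by (simp add: j H_simps)
  also have "\<dots> = (H p ^^ j) (H p (H (- p) x))" by (simp add: funpow_swap1)
  also have "\<dots> = (H p ^^ j) 0" unfolding 0 ..
  also have "\<dots> = 0" by (induction j) (simp_all add: H_simps)
  finally show False using nz p by (simp del: of_nat_Suc)
qed

text \<open>Adding the creation operator \<open>H (- Suc j)\<close> to the previous ones contributes the factor
  \<open>1 / (1 - q ^ Suc j)\<close> to the generating function of dimensions.\<close>
lemma heisenberg_independent:
  assumes c: "c \<le> 1" "v \<in> sec c" "v \<in> weight_space h k" and v: "v \<noteq> 0" "\<And>n. n > 0 \<Longrightarrow> H n v = 0"
  shows "\<exists>B. finite B \<and> independent B
    \<and> B \<subseteq> weight_space (h + of_nat M / 4) k \<inter> sec c \<inter> {u. \<forall>n>int j. H n u = 0}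
    \<and> of_nat (card B) = fps_nth (inverse (qpoch4 j)) M"
proof (induction j arbitrary: M)
  case 0
  show ?case
  proof (cases "M = 0")
    case True
    then show ?thesis using c v by (intro exI[of _ "{v}"]) auto
  next
    case False
    then show ?thesis by (intro exI[of _ "{}"]) (auto simp: independent_empty)
  qed
next
  case (Suc j)
  let ?W = "\<lambda>M. weight_space (h + of_nat M / 4) k"
  let ?K = "\<lambda>j. {u. \<forall>n>int j. H n u = 0}"
  define p where "p = int (Suc j)"
  note outer = Suc
  show ?case
  proof (induction M rule: less_induct)
    case (less M)
    \<comment> \<open>\<open>B1\<close> uses creation operators up to \<open>H (- j)\<close> only
      and is killed by \<open>H p\<close>. \<open>B2\<close> lies \<open>p\<close> units of energy
      lower and receives one more \<open>H (- p)\<close>, as in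
      \<open>inverse_qpoch4_Suc_nth\<close>.\<close>
    obtain B1 where B1: "finite B1" "independent B1" "B1 \<subseteq> ?W M \<inter> sec c \<inter> ?K j"
      "of_nat (card B1) = fps_nth (inverse (qpoch4 j)) M"
      using outer by blast
    show ?case
    proof (cases "4 * Suc j \<le> M")
      case False
      then have "fps_nth (inverse (qpoch4 (Suc j))) M = fps_nth (inverse (qpoch4 j)) M"
        by (subst inverse_qpoch4_Suc_nth) (simp only: if_False add_0_right)
      moreover have "?K j \<subseteq> ?K (Suc j)" by auto
      ultimately show ?thesis using B1 by (intro exI[of _ B1]) auto
    next
      case True
      define M' where "M' = M - 4 * Suc j"
      have "M' < M" using True by (simp add: M'_def)
      then obtain B2 where B2: "finite B2" "independent B2" "B2 \<subseteq> ?W M' \<inter> sec c \<inter> ?K (Suc j)"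
        "of_nat (card B2) = fps_nth (inverse (qpoch4 (Suc j))) M'"
        using less by blast
      have MM: "h + of_nat M' / 4 - of_int (- p) = h + of_nat M / 4"
        using True by (simp add: M'_def p_def field_simps)
      have sp: "span B2 \<subseteq> ?W M' \<inter> sec c"
        using B2(3) by (intro span_minimal subspace_inter subspace_weight_space sec_sub c) auto
      have inj: "x = 0" if x: "x \<in> span B2" "H p (H (- p) x) = 0" for x
      proof (rule H_pair_injective[OF _ c(1) _ _ x(2)])
        show "x \<in> sec c" "x \<in> ?W M'" using subsetD[OF sp x(1)] by blast+
      qed (simp add: p_def)
      have kill: "H p x = 0" if "x \<in> B1" for x using B1(3) that by (auto simp: p_def)
      have un: "independent (B1 \<union> H (- p) ` B2) \<and> card (B1 \<union> H (- p) ` B2) = card B1 + card B2"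
        by (rule independent_Un_image[of "H p" "H (- p)", OF _ _ B1(2,1) kill B2(1,2) inj])
           (use lin_aff in auto)
      have mem: "H (- p) x \<in> ?W M \<inter> sec c \<inter> ?K (Suc j)" if "x \<in> B2" for x
      proof -
        have x: "x \<in> ?W M'" "x \<in> sec c" "\<And>n. n > p \<Longrightarrow> H n x = 0" using B2(3) that by (auto simp: p_def)
        have "H n (H (- p) x) = 0" if "n > p" for n
          using HH[of n "- p" x] that x(3) by (simp add: H_simps)
        moreover have "H (- p) x \<in> ?W M" using H_weight[OF c(1) x(2,1), of "- p"] unfolding MM .
        ultimately show ?thesis using aff_sec[OF c(1) x(2)] by (simp add: p_def)
      qed
      have "of_nat (card B1 + card B2) = fps_nth (inverse (qpoch4 (Suc j))) M"
        using True by (subst inverse_qpoch4_Suc_nth) (simp add: B1(4) B2(4) M'_def)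
      moreover have "B1 \<union> H (- p) ` B2 \<subseteq> ?W M \<inter> sec c \<inter> ?K (Suc j)"
        using B1(3) mem by auto
      ultimately show ?thesis
        using un B1(1) B2(1) by (intro exI[of _ "B1 \<union> H (- p) ` B2"]) simp
    qed
  qed
qed

section \<open>The lowest state of each charge\<close>

text \<open>The index with shift 0 in \<open>decode\<close>; all larger indices of the same field
  annihilate \<open>fock_vac m j\<close>.\<close>

definition top_mode :: "nat \<Rightarrow> rat" where
  "top_mode j = - (2 * of_nat j + 1) / 4"

fun fock_vac :: "nat \<Rightarrow> nat \<Rightarrow> 'v" where
  "fock_vac m 0 = vac"
| "fock_vac m (Suc j) = phi m (top_mode j) (fock_vac m j)"

lemma valid_top_mode: "valid_mode (j mod 2) (top_mode j)"
  using valid_mode_decode[of j 0] by (simp add: top_mode_def)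

lemma fock_vac_sec: "m \<le> 1 \<Longrightarrow> fock_vac m j \<in> sec (j mod 2)"
proof (induction j)
  case (Suc j)
  then have "fock_vac m (Suc j) \<in> sec (1 - j mod 2)"
    unfolding fock_vac.simps by (intro phi_sec valid_top_mode) auto
  then show ?case by (simp add: mod2_eq_if split: if_splits)
qed (simp add: vac_sec)

lemma fock_vac_weight:
  "m \<le> 1 \<Longrightarrow> fock_vac m j \<in> weight_space (of_nat (j\<^sup>2) / 4) (int j * (1 - 2 * int m))"
proof (induction j)
  case (Suc j)
  then have "fock_vac m (Suc j) \<in> weight_space (of_nat (j\<^sup>2) / 4 - top_mode j)
      (int j * (1 - 2 * int m) + 1 - 2 * int m)"
    unfolding fock_vac.simps by (intro phi_weight) auto
  moreover have "of_nat (j\<^sup>2) / 4 - top_mode j = of_nat ((Suc j)\<^sup>2) / 4"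
    by (simp add: top_mode_def power2_eq_square field_simps)
  moreover have "int j * (1 - 2 * int m) + 1 - 2 * int m = int (Suc j) * (1 - 2 * int m)"
    by (simp add: algebra_simps)
  ultimately show ?case by (simp only:)
qed (simp add: vac_weight)

text \<open>For equal fields the \<open>\<gamma> = 1\<close> relation has right side 0, and every
  term except the wanted one applies an index above \<open>top_mode j\<close> first.\<close>

lemma phi_same_fock_vac:
  assumes m: "m \<le> 1"
  shows "r > top_mode j \<Longrightarrow> phi m r (fock_vac m j) = 0"
proof (induction j arbitrary: r)
  case 0
  then show ?case by (simp add: top_mode_def vac_phi)
next
  case (Suc j)
  define c where "c = j mod 2"
  define s where "s = top_mode j"
  define v where "v = fock_vac m j"
  have c: "c \<le> 1" by (simp add: c_def)
  have v: "v \<in> sec c" unfolding v_def c_def by (rule fock_vac_sec[OF m])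
  have s: "valid_mode c s" unfolding c_def s_def by (rule valid_top_mode)
  have IH: "phi m t v = 0" if "t > s" for t using Suc.IH that by (simp add: v_def s_def)
  have pv: "phi m s v \<in> sec (1 - c)" by (rule phi_sec[OF c m v s])
  have "phi m r (phi m s v) = 0"
  proof (cases "valid_mode (1 - c) r")
    case False
    then show ?thesis using pv by (intro phi_invalid[of "1 - c"]) auto
  next
    case r: True
    obtain k where k: "r + s = of_int k" using valid_mode_sum[OF c s r] .
    have "r - s > -1/2" using Suc.prems by (simp add: s_def top_mode_def field_simps)
    then have d: "r - s \<ge> 1/2" using valid_mode_gap[OF c s r] by simp
    have mm: "m = 0 \<or> m = 1" using m by auto
    have "phi m r (phi m s v) - sc (gcr_sign m m 1) (phi m (s + 1/2 - of_int 1) (phi m (r - 1/2 + of_int 1) v)) \<in> {0}"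
    proof (rule gcr_modulo[OF c v m m s r k subspace_single_0])
      show "(\<Sum>j<nat 1. sc ((of_rat r - 1/4 + of_int 1 - 1) gchoose (nat 1 - 1 - j)) (A m m j k v)) \<in> {0}"
        using mm A00 A11 by auto
      fix l :: nat assume l: "l \<ge> 1"
      show "phi m (r - of_nat l) (phi m (s + of_nat l) v) \<in> {0}"
        using l IH[of "s + of_nat l"] by (simp add: phi_simps)
      show "phi m (s + 1/2 - of_int 1 - of_nat l) (phi m (r - 1/2 + of_int 1 + of_nat l) v) \<in> {0}"
        using d IH[of "r - 1/2 + of_int 1 + of_nat l"] by (simp add: phi_simps)
    qed
    moreover have "phi m (r - 1/2 + of_int 1) v = 0" using d by (intro IH) simp
    ultimately show ?thesis by (simp add: phi_simps)
  qed
  then show ?case by (simp add: v_def s_def)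
qed

text \<open>For \<open>\<gamma> = 0\<close> the right side is empty. The exchange lowers
  \<open>t\<close> by 1/2, exactly the difference between the bounds for \<open>Suc j\<close> and
  \<open>j\<close>. At the bound itself, \<open>fock_vac_lower\<close> gives a nonzero value for
  \<open>Suc j\<close>.\<close>

lemma phi_other_fock_vac:
  assumes m: "m \<le> 1"
  shows "t > - top_mode j - 1/2 \<Longrightarrow> phi (1 - m) t (fock_vac m j) = 0"
proof (induction j arbitrary: t)
  case 0
  then show ?case by (simp add: top_mode_def vac_phi)
next
  case (Suc j)
  define c where "c = j mod 2"
  define s where "s = top_mode j"
  define v where "v = fock_vac m j"
  have c: "c \<le> 1" by (simp add: c_def)
  have v: "v \<in> sec c" unfolding v_def c_def by (rule fock_vac_sec[OF m])
  have s: "valid_mode c s" unfolding c_def s_def by (rule valid_top_mode)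
  have IH: "phi (1 - m) t v = 0" if "t > - s - 1/2" for t using Suc.IH that by (simp add: v_def s_def)
  have same: "phi m t v = 0" if "t > s" for t using phi_same_fock_vac[OF m] that by (simp add: v_def s_def)
  have pv: "phi m s v \<in> sec (1 - c)" by (rule phi_sec[OF c m v s])
  have t: "t > - s" using Suc.prems by (simp add: s_def top_mode_def field_simps)
  have "phi (1 - m) t (phi m s v) = 0"
  proof (cases "valid_mode (1 - c) t")
    case False
    then show ?thesis using pv by (intro phi_invalid[of "1 - c"]) auto
  next
    case vt: True
    obtain k where k: "t + s = of_int k" using valid_mode_sum[OF c s vt] .
    have c': "1 - c \<le> 1" "1 - (1 - c) = c" using c by auto
    show ?thesis
    proof (cases "m = 0")
      case True
      have vt': "valid_mode c (t - 1/2)" using valid_mode_shift(2)[OF c'(1), of t] vt c'(2) by simp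
      have vs': "valid_mode (1 - c) (s + 1/2)" using valid_mode_shift(1)[OF c'(1), of s] s c'(2) by simp
      have k': "s + 1/2 + (t - 1/2) = of_int k" using k by simp
      \<comment> \<open>The relation in the order \<open>(0, 1)\<close> is solved for its exchanged
        product here, and for its direct product in the case \<open>m = 1\<close>.\<close>
      have "phi 0 (s + 1/2) (phi 1 (t - 1/2) v)
          - sc (gcr_sign 0 1 0) (phi 1 (t - 1/2 + 1/2 - of_int 0) (phi 0 (s + 1/2 - 1/2 + of_int 0) v)) \<in> {0}"
      proof (rule gcr_modulo[OF c v _ _ vt' vs' k' subspace_single_0])
        fix l :: nat assume l: "l \<ge> 1"
        show "phi 0 (s + 1/2 - of_nat l) (phi 1 (t - 1/2 + of_nat l) v) \<in> {0}"
          using t True IH[of "t - 1/2 + of_nat l"] by (simp add: phi_simps)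
        show "phi 1 (t - 1/2 + 1/2 - of_int 0 - of_nat l) (phi 0 (s + 1/2 - 1/2 + of_int 0 + of_nat l) v) \<in> {0}"
          using l True same[of "s + of_nat l"] by (simp add: phi_simps)
      qed auto
      then show ?thesis using True t IH[of "t - 1/2"] by (simp add: phi_simps gcr_sign_def)
    next
      case False
      then have m1: "m = 1" using m by simp
      have "phi 0 t (phi 1 s v)
          - sc (gcr_sign 0 1 0) (phi 1 (s + 1/2 - of_int 0) (phi 0 (t - 1/2 + of_int 0) v)) \<in> {0}"
      proof (rule gcr_modulo[OF c v _ _ s vt k subspace_single_0])
        fix l :: nat assume l: "l \<ge> 1"
        show "phi 0 (t - of_nat l) (phi 1 (s + of_nat l) v) \<in> {0}"
          using l m1 same[of "s + of_nat l"] by (simp add: phi_simps)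
        show "phi 1 (s + 1/2 - of_int 0 - of_nat l) (phi 0 (t - 1/2 + of_int 0 + of_nat l) v) \<in> {0}"
          using t m1 IH[of "t - 1/2 + of_nat l"] by (simp add: phi_simps)
      qed auto
      then show ?thesis using m1 t IH[of "t - 1/2"] by (simp add: phi_simps)
    qed
  qed
  then show ?case by (simp add: v_def s_def)
qed

text \<open>At total index 0 the \<open>\<gamma> = 1\<close> relation has \<open>v\<close> on the
  right; the two preceding lemmas kill every other term on the left. The purpose is that the lowest
  states cannot vanish.\<close>

lemma fock_vac_lower:
  assumes m: "m \<le> 1"
  shows "phi (1 - m) (- top_mode j) (fock_vac m (Suc j)) = fock_vac m j"
proof -
  define c where "c = j mod 2"
  define s where "s = top_mode j"
  define v where "v = fock_vac m j"
  have c: "c \<le> 1" by (simp add: c_def)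
  have v: "v \<in> sec c" unfolding v_def c_def by (rule fock_vac_sec[OF m])
  have s: "valid_mode c s" unfolding c_def s_def by (rule valid_top_mode)
  have other: "phi (1 - m) t v = 0" if "t > - s - 1/2" for t
    using phi_other_fock_vac[OF m] that by (simp add: v_def s_def)
  have same: "phi m t v = 0" if "t > s" for t using phi_same_fock_vac[OF m] that by (simp add: v_def s_def)
  have val: "valid_mode c (- s + 1/2)" "valid_mode (1 - c) (- s)"
    "valid_mode (1 - c) (s - 1/2)"
  proof -
    show "valid_mode (1 - c) (s - 1/2)" using valid_mode_shift(2)[OF c] s by simp
    have "- s - of_nat (1 - c) / 2 + 1/4 = - (s - of_nat c / 2 + 1/4)"
      using c by (cases "c = 0") (auto simp: field_simps)
    then show *: "valid_mode (1 - c) (- s)" using s unfolding valid_mode_def by (metis Ints_minus)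
    show "valid_mode c (- s + 1/2)" using valid_mode_shift(1)[OF c, of "- s"] * by simp
  qed
  have A: "(\<Sum>j<nat 1. sc ((of_rat r - 1/4 + of_int 1 - 1) gchoose (nat 1 - 1 - j)) (A 0 1 j 0 v)) = v" for r
    using A01[of 0 v] by simp
  have sgn: "gcr_sign 0 1 1 = -1" by (simp add: gcr_sign_def)
  have "phi (1 - m) (- s) (phi m s v) = v"
  proof (cases "m = 0")
    case True
    have k: "s - 1/2 + (- s + 1/2) = of_int 0" by simp
    have "phi 0 (s - 1/2) (phi 1 (- s + 1/2) v)
          - sc (gcr_sign 0 1 1) (phi 1 (- s + 1/2 + 1/2 - of_int 1) (phi 0 (s - 1/2 - 1/2 + of_int 1) v))
          - (\<Sum>j<nat 1. sc ((of_rat (s - 1/2) - 1/4 + of_int 1 - 1) gchoose (nat 1 - 1 - j)) (A 0 1 j 0 v)) \<in> {0}"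
    proof (rule gcr_modulo_diff[OF c v _ _ val(1,3) k subspace_single_0])
      fix l :: nat assume l: "l \<ge> 1"
      show "phi 0 (s - 1/2 - of_nat l) (phi 1 (- s + 1/2 + of_nat l) v) \<in> {0}"
        using True other[of "- s + 1/2 + of_nat l"] by (simp add: phi_simps)
      show "phi 1 (- s + 1/2 + 1/2 - of_int 1 - of_nat l) (phi 0 (s - 1/2 - 1/2 + of_int 1 + of_nat l) v) \<in> {0}"
        using l True same[of "s + of_nat l"] by (simp add: phi_simps)
    qed auto
    then show ?thesis unfolding A sgn using True other[of "- s + 1/2"] by (simp add: phi_simps)
  next
    case False
    then have m1: "m = 1" using m by simp
    have k: "- s + s = of_int 0" by simp
    have "phi 0 (- s) (phi 1 s v)
          - sc (gcr_sign 0 1 1) (phi 1 (s + 1/2 - of_int 1) (phi 0 (- s - 1/2 + of_int 1) v))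
          - (\<Sum>j<nat 1. sc ((of_rat (- s) - 1/4 + of_int 1 - 1) gchoose (nat 1 - 1 - j)) (A 0 1 j 0 v)) \<in> {0}"
    proof (rule gcr_modulo_diff[OF c v _ _ s val(2) k subspace_single_0])
      fix l :: nat assume l: "l \<ge> 1"
      show "phi 0 (- s - of_nat l) (phi 1 (s + of_nat l) v) \<in> {0}"
        using l m1 same[of "s + of_nat l"] by (simp add: phi_simps)
      show "phi 1 (s + 1/2 - of_int 1 - of_nat l) (phi 0 (- s - 1/2 + of_int 1 + of_nat l) v) \<in> {0}"
        using m1 other[of "- s + 1/2 + of_nat l"] by (simp add: phi_simps algebra_simps)
    qed auto
    then show ?thesis unfolding A sgn using m1 other[of "- s + 1/2"] by (simp add: phi_simps)
  qed
  then show ?thesis by (simp add: v_def s_def)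
qed

lemma fock_vac_nonzero: "m \<le> 1 \<Longrightarrow> fock_vac m j \<noteq> 0"
proof (induction j)
  case (Suc j)
  then show ?case using fock_vac_lower[of m j] by (metis module_hom.zero[OF linear_phi])
qed (simp add: vac_nz)

lemma H_fock_vac:
  assumes "m \<le> 1" "n > 0"
  shows "H n (fock_vac m j) = 0"
proof (induction j)
  case 0
  then show ?case using vac_aff assms(2) by simp
next
  case (Suc j)
  have "phi m (of_int n + top_mode j) (fock_vac m j) = 0"
    using assms(2) by (intro phi_same_fock_vac assms) simp
  then show ?case using H_phi[OF assms(1), of n "top_mode j" "fock_vac m j"] Suc by (simp add: phi_simps)
qed

section \<open>Comparison of dimensions and the basis\<close>

lemma weight_space_dim_ge:
  "\<exists>B. finite B \<and> independent B \<and> B \<subseteq> weight_space (of_nat N / 4) k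
     \<and> of_nat (card B) = chi_coeff k N"
proof (cases "(nat \<bar>k\<bar>)\<^sup>2 \<le> N")
  case False
  then show ?thesis by (intro exI[of _ "{}"]) (simp add: chi_coeff_eq independent_empty)
next
  case True
  define m :: nat where "m = (if k \<ge> 0 then 0 else 1)"
  define j where "j = nat \<bar>k\<bar>"
  have m: "m \<le> 1" by (simp add: m_def)
  have k: "int j * (1 - 2 * int m) = k" by (auto simp: m_def j_def)
  have eq: "of_nat (j\<^sup>2) / 4 + of_nat (N - j\<^sup>2) / 4 = (of_nat N / 4 :: rat)"
    using True by (simp add: j_def field_simps)
  \<comment> \<open>Creation operators up to \<open>H (- N)\<close> suffice in this degree, and
    \<open>N\<close> is the index used in \<open>chi_coeff_eq\<close>.\<close>
  have "\<exists>B. finite B \<and> independent B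
    \<and> B \<subseteq> weight_space (of_nat (j\<^sup>2) / 4 + of_nat (N - j\<^sup>2) / 4) k \<inter> sec (j mod 2) \<inter> {u. \<forall>n>int N. H n u = 0}
    \<and> of_nat (card B) = fps_nth (inverse (qpoch4 N)) (N - j\<^sup>2)"
    using fock_vac_weight[OF m, of j] unfolding k
    by (intro heisenberg_independent[OF _ fock_vac_sec[OF m]] fock_vac_nonzero H_fock_vac m) auto
  moreover have "chi_coeff k N = fps_nth (inverse (qpoch4 N)) (N - j\<^sup>2)"
    using True by (simp add: chi_coeff_eq j_def)
  ultimately show ?thesis unfolding eq by auto
qed

text \<open>The number of admissible lists equals the size of an independent set in their span, so a
  repeated or redundant state would leave a spanning set that is too small.\<close>

lemma adm_weight_basis:
  "inj_on mono (adm_weight h k)" "independent (mono ` adm_weight h k)" "finite (adm_weight h k)"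
  "of_nat (card (adm_weight h k))
     = (if \<exists>N::nat. h = of_nat N / 4 then chi_coeff k (nat \<lfloor>4 * h\<rfloor>) else 0)"
proof -
  let ?P = "adm_weight h k"
  have "inj_on mono ?P \<and> independent (mono ` ?P) \<and> finite ?P \<and> of_nat (card ?P)
     = (if \<exists>N::nat. h = of_nat N / 4 then chi_coeff k (nat \<lfloor>4 * h\<rfloor>) else 0)"
  proof (cases "\<exists>N::nat. h = of_nat N / 4")
    case False
    then have "?P = {}" using energy_adm_nat by (auto simp: adm_weight_def)
    then show ?thesis using False by (simp add: independent_empty)
  next
    case True
    then obtain N :: nat where h: "h = of_nat N / 4" by blast
    have fin: "finite ?P" and card: "of_nat (card ?P) = chi_coeff k N"
      using card_adm_weight[of N k] by (simp_all add: adm_weight_def h)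
    obtain B where B: "finite B" "independent B" "B \<subseteq> span (mono ` ?P)"
      and cB: "of_nat (card B) = chi_coeff k N"
      using weight_space_dim_ge[of N k] unfolding h[symmetric] weight_space_eq_span by blast
    have BP: "card B = card ?P" using cB card by (metis of_nat_eq_iff)
    have bound: "card ?P \<le> card T" if "finite T" "span T = span (mono ` ?P)" for T
      using independent_span_bound[OF that(1) B(2)] B(3) BP that(2) by simp
    have "card ?P \<le> card (mono ` ?P)" using fin by (intro bound) auto
    then have ceq: "card (mono ` ?P) = card ?P" using card_image_le[OF fin, of mono] by simp
    have inj: "inj_on mono ?P" using eq_card_imp_inj_on[OF fin ceq] .
    have "independent (mono ` ?P)"
    proof
      assume "dependent (mono ` ?P)"
      then obtain a where a: "a \<in> mono ` ?P" "a \<in> span (mono ` ?P - {a})" unfolding dependent_def by blast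
      have "span (mono ` ?P - {a}) = span (mono ` ?P)"
        using span_redundant[OF a(2)] a(1) by (simp add: insert_absorb)
      then have "card ?P \<le> card (mono ` ?P - {a})" using fin by (intro bound) auto
      moreover have "card (mono ` ?P - {a}) < card (mono ` ?P)" using fin a(1) by (intro card_Diff1_less) auto
      ultimately show False using ceq by simp
    qed
    moreover have "nat \<lfloor>4 * h\<rfloor> = N" by (simp add: h)
    ultimately show ?thesis using inj fin card True by simp
  qed
  then show "inj_on mono ?P" "independent (mono ` ?P)" "finite ?P"
    "of_nat (card ?P) = (if \<exists>N::nat. h = of_nat N / 4 then chi_coeff k (nat \<lfloor>4 * h\<rfloor>) else 0)"
    by blast+
qed

text \<open>Equal states of different weights would be zero, and zero does not belong to an
  independent set.\<close>

lemma mono_inj_adm: "inj_on mono (Collect adm)"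
proof (rule inj_onI)
  fix xs ys assume xs: "xs \<in> Collect adm" and ys: "ys \<in> Collect adm" and eq: "mono xs = mono ys"
  define w where "w = (energy xs, charge xs)"
  define w' where "w' = (energy ys, charge ys)"
  have P: "xs \<in> adm_weight (fst w) (snd w)" "ys \<in> adm_weight (fst w') (snd w')"
    using xs ys by (simp_all add: adm_weight_def w_def w'_def)
  show "xs = ys"
  proof (cases "w = w'")
    case True
    then show ?thesis using adm_weight_basis(1)[of "fst w" "snd w"] P eq by (auto dest: inj_onD)
  next
    case False
    define x where "x u = (if u = w then mono xs else - mono ys)" for u
    have "x w = 0"
    proof (rule weight_sum_eq_0[of "{w, w'}"])
      fix u assume "u \<in> {w, w'}"
      moreover have "mono xs \<in> weight_space (fst w) (snd w)" "mono ys \<in> weight_space (fst w') (snd w')"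
        using xs ys by (simp_all add: mono_weight w_def w'_def)
      ultimately show "x u \<in> weight_space (fst u) (snd u)"
        using False by (auto simp: x_def intro: subspace_neg[OF subspace_weight_space])
    next
      show "sum x {w, w'} = 0" using False eq by (simp add: x_def)
    qed auto
    then have "mono xs = 0" by (simp add: x_def)
    then have "0 \<in> mono ` adm_weight (fst w) (snd w)" using P(1) by (metis imageI)
    then show ?thesis using adm_weight_basis(2) dependent_zero by blast
  qed
qed

text \<open>The component of one weight in a linear relation is a relation inside a single weight
  space.\<close>

lemma independent_adm: "independent (mono ` Collect adm)"
proof
  assume "dependent (mono ` Collect adm)"
  then obtain t u v where t: "finite t" "t \<subseteq> mono ` Collect adm" "(\<Sum>a\<in>t. sc (u a) a) = 0"
    and v: "v \<in> t" "u v \<noteq> 0"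
    unfolding dependent_explicit by blast
  obtain X where X: "X \<subseteq> Collect adm" "inj_on mono X" "t = mono ` X"
    using t(2) unfolding subset_image_inj by blast
  have fX: "finite X" using t(1) X by (simp add: finite_image_iff)
  obtain xs where xs: "xs \<in> X" "v = mono xs" using v X(3) by blast
  define g where "g xs = (energy xs, charge xs)" for xs
  define y where "y w = (\<Sum>a\<in>mono ` {xs\<in>X. g xs = w}. sc (u a) a)" for w
  have yw: "y w = (\<Sum>xs\<in>{xs\<in>X. g xs = w}. sc (u (mono xs)) (mono xs))" for w
    unfolding y_def by (subst sum.reindex) (auto intro: inj_on_subset[OF X(2)])
  have "y (g xs) = 0"
  proof (rule weight_sum_eq_0[of "g ` X" y])
    show "(\<Sum>w\<in>g ` X. y w) = 0"
      unfolding yw sum.image_gen[OF fX, symmetric] using t(3) unfolding X(3) by (simp add: sum.reindex[OF X(2)])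
    show "y w \<in> weight_space (fst w) (snd w)" for w
      unfolding yw using X(1) mono_weight
      by (intro subspace_sum[OF subspace_weight_space] subspace_scale[OF subspace_weight_space])
         (auto simp: g_def)
  qed (use fX xs in auto)
  moreover have "mono ` {zs\<in>X. g zs = g xs} \<subseteq> mono ` adm_weight (energy xs) (charge xs)"
    using X(1) by (auto simp: adm_weight_def g_def)
  ultimately have "u v = 0"
    unfolding y_def using adm_weight_basis(2) fX xs
    by (intro independentD[of "mono ` adm_weight (energy xs) (charge xs)" "mono ` {zs\<in>X. g zs = g xs}"]) auto
  then show False using v by simp
qed

end

text \<open>The trace formula is stated coefficientwise: the joint eigenspaces span, so
  \<open>L0\<close> and \<open>H 0\<close> are diagonalisable, and each has the dimension prescribed
  by the series.\<close>

theorem theorem7: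
  fixes sc :: "complex \<Rightarrow> 'v::ab_group_add \<Rightarrow> 'v"
    and E H F :: "int \<Rightarrow> 'v \<Rightarrow> 'v"
    and phi :: "nat \<Rightarrow> rat \<Rightarrow> 'v \<Rightarrow> 'v"
    and A :: "nat \<Rightarrow> nat \<Rightarrow> nat \<Rightarrow> int \<Rightarrow> 'v \<Rightarrow> 'v"
    and vac :: 'v
    and sec :: "nat \<Rightarrow> 'v set"
  assumes vs: "vector_space sc"
    and lin_aff: "\<And>n. Vector_Spaces.linear sc sc (E n) \<and> Vector_Spaces.linear sc sc (H n)
                        \<and> Vector_Spaces.linear sc sc (F n)"
    and lin_phi: "\<And>m r. Vector_Spaces.linear sc sc (phi m r)"
    and lin_A: "\<And>m n j k. Vector_Spaces.linear sc sc (A m n j k)"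
    \<comment> \<open>level-1 affine sl(2) relations\<close>
    and HE: "\<And>a b v. H a (E b v) - E b (H a v) = sc 2 (E (a+b) v)"
    and HF: "\<And>a b v. H a (F b v) - F b (H a v) = sc (-2) (F (a+b) v)"
    and EF: "\<And>a b v. E a (F b v) - F b (E a v)
                      = H (a+b) v + (if a + b = 0 then sc (of_int a) v else 0)"
    and HH: "\<And>a b v. H a (H b v) - H b (H a v) = (if a + b = 0 then sc (2 * of_int a) v else 0)"
    and EE: "\<And>a b v. E a (E b v) = E b (E a v)"
    and FF: "\<And>a b v. F a (F b v) = F b (F a v)"
    \<comment> \<open>relations between affine modes and the simple-current modes\<close>
    and E_phi1: "\<And>a s v. E a (phi 1 s v) + phi 1 s (E a v) = phi 0 (of_int a + s) v"
    and E_phi0: "\<And>a s v. E a (phi 0 s v) + phi 0 s (E a v) = 0"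
    and H_phi: "\<And>a m s v. m \<le> 1 \<Longrightarrow>
                   H a (phi m s v) - phi m s (H a v) = sc (1 - 2 * of_nat m) (phi m (of_int a + s) v)"
    and F_phi0: "\<And>a s v. F a (phi 0 s v) + phi 0 s (F a v) = phi 1 (of_int a + s) v"
    and F_phi1: "\<And>a s v. F a (phi 1 s v) + phi 1 s (F a v) = 0"
    \<comment> \<open>charge sectors (sec 0: charge 0, sec 1: charge 1/2) and mode-index conventions\<close>
    and sec_sub: "\<And>c. c \<le> 1 \<Longrightarrow> module.subspace sc (sec c)"
    and sec_direct: "sec 0 \<inter> sec 1 = {0}"
    and sec_all: "\<And>v. \<exists>v0 v1. v0 \<in> sec 0 \<and> v1 \<in> sec 1 \<and> v = v0 + v1"
    and aff_sec: "\<And>c n v. c \<le> 1 \<Longrightarrow> v \<in> sec c \<Longrightarrow>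
                    E n v \<in> sec c \<and> H n v \<in> sec c \<and> F n v \<in> sec c"
    and phi_sec: "\<And>c m r v. c \<le> 1 \<Longrightarrow> m \<le> 1 \<Longrightarrow> v \<in> sec c \<Longrightarrow> valid_mode c r \<Longrightarrow>
                    phi m r v \<in> sec (1 - c)"
    and phi_invalid: "\<And>c m r v. c \<le> 1 \<Longrightarrow> v \<in> sec c \<Longrightarrow> \<not> valid_mode c r \<Longrightarrow> phi m r v = 0"
    \<comment> \<open>vacuum\<close>
    and vac_sec: "vac \<in> sec 0"
    and vac_nz: "vac \<noteq> 0"
    and vac_aff: "\<And>n. n > 0 \<Longrightarrow> E n vac = 0 \<and> H n vac = 0 \<and> F n vac = 0"
    and vac_E0: "E 0 vac = 0"
    and vac_H0: "H 0 vac = 0"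
    and vac_phi: "\<And>m r. r > -1/4 \<Longrightarrow> phi m r vac = 0"
    and posen: "pos_energy E H F phi"
    \<comment> \<open>conformal dimension 1/4 of the simple current fields\<close>
    and L0_phi: "\<And>m r v. m \<le> 1 \<Longrightarrow>
        sugawaraL0 sc E H F (phi m r v) - phi m r (sugawaraL0 sc E H F v)
          = sc (- of_rat r) (phi m r v)"
    \<comment> \<open>leading OPE data of the vacuum-module fields A^(m,n;j)\<close>
    and A00: "\<And>k v. A 0 0 0 k v = 0 \<and> A 0 0 1 k v = E k v"
    and A01: "\<And>k v. A 0 1 0 k v = (if k = 0 then v else 0) \<and> A 0 1 1 k v = sc (1/2) (H k v)"
    and A11: "\<And>k v. A 1 1 0 k v = 0 \<and> A 1 1 1 k v = F k v"
    \<comment> \<open>generalised commutation relations, for every gamma\<close>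
    and gcr: "\<And>c v m n \<gamma> r s k. c \<le> 1 \<Longrightarrow> v \<in> sec c \<Longrightarrow> m \<le> 1 \<Longrightarrow> n \<le> 1 \<Longrightarrow>
        valid_mode c s \<Longrightarrow> valid_mode (1 - c) r \<Longrightarrow> r + s = of_int k \<Longrightarrow>
        eventually_sums
          (\<lambda>l. sc ((of_nat l - 1/2 + of_int \<gamma> - 1) gchoose l)
                  (phi m (r - of_nat l) (phi n (s + of_nat l) v)
                   - sc (gcr_sign m n \<gamma>)
                       (phi n (s + 1/2 - of_int \<gamma> - of_nat l) (phi m (r - 1/2 + of_int \<gamma> + of_nat l) v))))
          (\<Sum>j<nat \<gamma>. sc ((of_rat r - 1/4 + of_int \<gamma> - 1) gchoose (nat \<gamma> - 1 - j)) (A m n j k v))"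
    \<comment> \<open>irreducibility as a module over the algebra generated by all modes\<close>
    and irred: "\<And>W. module.subspace sc W \<Longrightarrow> W \<noteq> {0} \<Longrightarrow>
        (\<forall>n. \<forall>w\<in>W. E n w \<in> W \<and> H n w \<in> W \<and> F n w \<in> W) \<Longrightarrow>
        (\<forall>m\<le>1. \<forall>r. \<forall>w\<in>W. phi m r w \<in> W) \<Longrightarrow> W = UNIV"
  shows "inj_on (mono_state phi vac) {xs. admissible xs}
       \<and> \<not> module.dependent sc (mono_state phi vac ` {xs. admissible xs})
       \<and> module.span sc (mono_state phi vac ` {xs. admissible xs}) = UNIV
       \<and> (let W = (\<lambda>(h::rat) (k::int). {v. sugawaraL0 sc E H F v = sc (of_rat h) v
                                          \<and> H 0 v = sc (of_int k) v})
          in module.span sc (\<Union>h k. W h k) = UNIV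
           \<and> (\<forall>h k. \<exists>B. finite B \<and> B \<subseteq> W h k \<and> \<not> module.dependent sc B
                   \<and> module.span sc B = W h k
                   \<and> of_nat (card B) = (if \<exists>N::nat. h = of_nat N / 4
                                         then chi_coeff k (nat \<lfloor>4 * h\<rfloor>) else 0)))"
proof -
  interpret simple_current_module sc E H F phi A vac sec
    by (intro simple_current_module.intro simple_current_module_axioms.intro; fact)
  have adm: "{xs. admissible xs} = Collect adm" by (simp add: admissible_iff_adm)
  have W: "{v. sugawaraL0 sc E H F v = sc (of_rat h) v \<and> H 0 v = sc (of_int k) v} = weight_space h k" for h k
    by (simp add: weight_space_def)
  have "mono ` Collect adm \<subseteq> (\<Union>h k. weight_space h k)"
    using mono_weight by blast
  then have "span (\<Union>h k. weight_space h k) = UNIV"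
    using span_mono span_adm by blast
  moreover have "\<exists>B. finite B \<and> B \<subseteq> weight_space h k \<and> independent B \<and> span B = weight_space h k
      \<and> of_nat (card B) = (if \<exists>N::nat. h = of_nat N / 4 then chi_coeff k (nat \<lfloor>4 * h\<rfloor>) else 0)" for h k
    using adm_weight_basis[of h k] weight_space_eq_span[of h k]
    by (intro exI[of _ "mono ` adm_weight h k"]) (simp add: card_image span_superset)
  ultimately show ?thesis
    unfolding adm Let_def W using mono_inj_adm independent_adm span_adm by blast
qed

end
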